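(* Let $\mathcal{P}$ be a chiral or directly regular $n$-polytope of type $\{p_1,\dots,p_{n-1}\}$, and let $\mathcal{Q}$ be a chiral or directly regular $n$-polytope of type $\{q_1,\dots,q_{n-1}\}$. If $p_i$ and $q_i$ are relatively prime for each $i=2,\dots,n-2$ (but not necessarily for $i=1$ or $i=n-1$), then $\mathcal{P}\diamond\mathcal{Q}$ is a chiral or directly regular $n$-polytope (i.e., it is polytopal).
   Context: All polytopes are abstract polytopes. A regular $n$-polytope has automorphism group generated by involutions $\rho_0,\dots,\rho_{n-1}$ (relative to a base flag); it is directly regular if the subgroup generated by $\sigma_i=\rho_{i-1}\rho_i$ ($i=1,\dots,n-1$), the rotation group $\Gamma^+(\mathcal{P})$, has index $2$. A polytope is chiral if its automorphism group has two orbits on flags, with adjacent flags in distinct orbits; then $\Gamma^+(\mathcal{P})$ denotes the full automorphism group, generated by the standard rotations $\sigma_1,\dots,\sigma_{n-1}$ relative to a base flag. In both cases $(\sigma_i\cdots\sigma_j)^2=1$ for $i<j$, and the type of $\mathcal{P}$ is $\{p_1,\dots,p_{n-1}\}$ where $p_i$ is the order of $\sigma_i$. For a group $\Gamma^+=\langle\sigma_1,\dots,\sigma_{n-1}\rangle$ with these relations, set $\tau_{i,j}=\sigma_i\sigma_{i+1}\cdots\sigma_j$ for $1\le i\le j\le n-1$, $\tau_{0,i}=\tau_{i,n}=1$, and for $I\subseteq\{-1,0,\dots,n\}$ let $\Gamma^+_I=\langle \tau_{i,j}: i\le j,\ i-1\in I,\ j\in I\rangle$; the intersection property is $\Gamma^+_I\cap\Gamma^+_J=\Gamma^+_{I\cap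 J}$ for all $I,J$. Mix: with $\Gamma^+(\mathcal{P})=\langle\sigma_1,\dots,\sigma_{n-1}\rangle$ and $\Gamma^+(\mathcal{Q})=\langle\sigma_1',\dots,\sigma_{n-1}'\rangle$, the group $\Gamma^+(\mathcal{P})\diamond\Gamma^+(\mathcal{Q})$ is the subgroup of $\Gamma^+(\mathcal{P})\times\Gamma^+(\mathcal{Q})$ generated by $\beta_i=(\sigma_i,\sigma_i')$; the mix $\mathcal{P}\diamond\mathcal{Q}$ is the chiral or directly regular flag-connected pre-polytope built from this group with distinguished generators $\beta_1,\dots,\beta_{n-1}$ (so $\Gamma^+(\mathcal{P}\diamond\mathcal{Q})=\Gamma^+(\mathcal{P})\diamond\Gamma^+(\mathcal{Q})$), and it is a polytope exactly when this group satisfies the intersection property with respect to $\beta_1,\dots,\beta_{n-1}$. *)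

theory Defs
  imports "HOL-Algebra.Algebra"
begin

section \<open>Abstract polytopes\<close>

text \<open>
  A poset is given by its reflexive order relation r; its set of faces is then Field r.
  The rank of a face x is determined by any flag through x: the faces of the flag up to and
  including x have ranks -1, 0, ..., rank x.
\<close>

definition flags :: "'a rel \<Rightarrow> 'a set set" where
  "flags r = {\<Phi> \<in> Chains r. \<forall>\<Psi> \<in> Chains r. \<Phi> \<subseteq> \<Psi> \<longrightarrow> \<Psi> = \<Phi>}"

definition face_rank :: "'a rel \<Rightarrow> 'a \<Rightarrow> int" where
  "face_rank r x = (THE k. \<exists>\<Phi> \<in> flags r. x \<in> \<Phi> \<and> k = int (card {y \<in> \<Phi>. (y, x) \<in> r}) - 2)"

definition adjacent :: "'a rel \<Rightarrow> int \<Rightarrow> 'a set \<Rightarrow> 'a set \<Rightarrow> bool" where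
  "adjacent r i \<Phi> \<Psi> \<longleftrightarrow> \<Phi> \<in> flags r \<and> \<Psi> \<in> flags r \<and> \<Phi> \<noteq> \<Psi> \<and>
     {x \<in> \<Phi>. face_rank r x \<noteq> i} = {x \<in> \<Psi>. face_rank r x \<noteq> i}"

definition strongly_flag_connected :: "'a rel \<Rightarrow> bool" where
  "strongly_flag_connected r \<longleftrightarrow>
     (\<forall>\<Phi> \<in> flags r. \<forall>\<Psi> \<in> flags r.
        (\<Phi>, \<Psi>) \<in> {(A, B). (\<exists>i. adjacent r i A B) \<and> \<Phi> \<inter> \<Psi> \<subseteq> A \<and> \<Phi> \<inter> \<Psi> \<subseteq> B}\<^sup>*)"

text \<open>
  Besides the least and the greatest face (of rank -1 and n), every flag contains n proper faces.
\<close>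

definition abstract_polytope :: "nat \<Rightarrow> 'a rel \<Rightarrow> bool" where
  "abstract_polytope n r \<longleftrightarrow>
     Partial_order r \<and>
     (\<exists>x \<in> Field r. \<forall>y \<in> Field r. (x, y) \<in> r) \<and>
     (\<exists>x \<in> Field r. \<forall>y \<in> Field r. (y, x) \<in> r) \<and>
     (\<forall>\<Phi> \<in> flags r. finite \<Phi> \<and> card \<Phi> = n + 2) \<and>
     (\<forall>x y. (x, y) \<in> r \<and> face_rank r y = face_rank r x + 2 \<longrightarrow>
        card {z. z \<noteq> x \<and> z \<noteq> y \<and> (x, z) \<in> r \<and> (z, y) \<in> r} = 2) \<and>
     strongly_flag_connected r"


section \<open>Automorphisms, regularity and chirality\<close>

text \<open>
  Automorphisms are composed as functions acting from the left. Following the library's group of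
  bijections, they are extensional outside the set of faces. They act on flags by taking images.
\<close>

definition aut_group :: "'a rel \<Rightarrow> ('a \<Rightarrow> 'a) monoid" where
  "aut_group r = (BijGroup (Field r))
     \<lparr>carrier := {f \<in> Bij (Field r).
        \<forall>x \<in> Field r. \<forall>y \<in> Field r. (f x, f y) \<in> r \<longleftrightarrow> (x, y) \<in> r}\<rparr>"

definition regular_polytope :: "nat \<Rightarrow> 'a rel \<Rightarrow> bool" where
  "regular_polytope n r \<longleftrightarrow> abstract_polytope n r \<and>
     (\<forall>\<Phi> \<in> flags r. \<forall>\<Psi> \<in> flags r. \<exists>f \<in> carrier (aut_group r). f ` \<Phi> = \<Psi>)"

definition chiral_polytope :: "nat \<Rightarrow> 'a rel \<Rightarrow> bool" where
  "chiral_polytope n r \<longleftrightarrow> abstract_polytope n r \<and>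
     card (orbits (aut_group r) (flags r) image) = 2 \<and>
     (\<forall>i \<Phi> \<Psi>. adjacent r i \<Phi> \<Psi> \<longrightarrow>
        orbit (aut_group r) image \<Phi> \<noteq> orbit (aut_group r) image \<Psi>)"

definition adj_flag :: "'a rel \<Rightarrow> int \<Rightarrow> 'a set \<Rightarrow> 'a set" where
  "adj_flag r i \<Phi> = (THE \<Psi>. adjacent r i \<Phi> \<Psi>)"

definition aut_taking :: "'a rel \<Rightarrow> 'a set \<Rightarrow> 'a set \<Rightarrow> 'a \<Rightarrow> 'a" where
  "aut_taking r \<Phi> \<Psi> = (THE f. f \<in> carrier (aut_group r) \<and> f ` \<Phi> = \<Psi>)"

definition \<rho> :: "'a rel \<Rightarrow> 'a set \<Rightarrow> nat \<Rightarrow> 'a \<Rightarrow> 'a" where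
  "\<rho> r \<Phi> i = aut_taking r \<Phi> (adj_flag r (int i) \<Phi>)"

definition directly_regular_polytope :: "nat \<Rightarrow> 'a rel \<Rightarrow> bool" where
  "directly_regular_polytope n r \<longleftrightarrow> regular_polytope n r \<and>
     (\<forall>\<Phi> \<in> flags r.
        card (rcosets\<^bsub>aut_group r\<^esub>
          (generate (aut_group r)
             ((\<lambda>i. \<rho> r \<Phi> (i - 1) \<otimes>\<^bsub>aut_group r\<^esub> \<rho> r \<Phi> i) ` {1..n - 1}))) = 2)"

text \<open>
  The standard rotations, for i = 1, ..., n - 1. With automorphisms acting from the left,
  the product of the two reflections takes the base flag to the i-adjacent flag of its
  (i - 1)-adjacent flag; in a chiral polytope this property defines the rotation. It is the
  choice for which all products of at least two consecutive rotations are involutions.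
\<close>

definition \<sigma> :: "nat \<Rightarrow> 'a rel \<Rightarrow> 'a set \<Rightarrow> nat \<Rightarrow> 'a \<Rightarrow> 'a" where
  "\<sigma> n r \<Phi> i =
     (if regular_polytope n r then \<rho> r \<Phi> (i - 1) \<otimes>\<^bsub>aut_group r\<^esub> \<rho> r \<Phi> i
      else aut_taking r \<Phi> (adj_flag r (int i) (adj_flag r (int i - 1) \<Phi>)))"

definition rotation_group :: "nat \<Rightarrow> 'a rel \<Rightarrow> 'a set \<Rightarrow> ('a \<Rightarrow> 'a) monoid" where
  "rotation_group n r \<Phi> =
     (aut_group r)\<lparr>carrier := generate (aut_group r) (\<sigma> n r \<Phi> ` {1..n - 1})\<rparr>"

text \<open>
  An infinite entry of the type is represented by 0, the order of an element of infinite order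
  in the library. No entry is 1, as the rotations are nontrivial; so an entry 0 is not
  coprime to any entry of the type of another polytope.
\<close>

definition has_type :: "nat \<Rightarrow> 'a rel \<Rightarrow> 'a set \<Rightarrow> (nat \<Rightarrow> nat) \<Rightarrow> bool" where
  "has_type n r \<Phi> p \<longleftrightarrow>
     (\<forall>i \<in> {1..n - 1}. p i = group.ord (rotation_group n r \<Phi>) (\<sigma> n r \<Phi> i))"


section \<open>The poset built from a rotation group\<close>

definition \<tau> :: "('g, 'm) monoid_scheme \<Rightarrow> nat \<Rightarrow> (nat \<Rightarrow> 'g) \<Rightarrow> nat \<Rightarrow> nat \<Rightarrow> 'g" where
  "\<tau> G n s i j =
     (if i = 0 \<or> j = n then \<one>\<^bsub>G\<^esub>
      else foldr (\<lambda>k x. s k \<otimes>\<^bsub>G\<^esub> x) [i..<Suc j] \<one>\<^bsub>G\<^esub>)"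

definition \<Gamma> :: "('g, 'm) monoid_scheme \<Rightarrow> nat \<Rightarrow> (nat \<Rightarrow> 'g) \<Rightarrow> int set \<Rightarrow> 'g set" where
  "\<Gamma> G n s I = generate G {\<tau> G n s i j | i j. i \<le> j \<and> j \<le> n \<and> int i - 1 \<in> I \<and> int j \<in> I}"

text \<open>
  The faces of rank i are the left cosets of the stabilizer of the base i-face, which is
  \<open>\<Gamma>\<close> for the index set {-1..n} - {i}; here \<open>g \<Gamma>\<^sub>i\<close> stands for the image of the base
  i-face under g. For n \<open>\<ge>\<close> 3, incidence is nonempty intersection of cosets.

  For n = 2 this would miss half of the incidences, since an incident vertex and edge determine a
  flag that may lie in the other orbit of the rotation group: the cosets of the vertex and edge
  stabilizers are singletons, and the edge g is incident with both of the vertices g and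
  \<open>g \<sigma>\<^sub>1\<close>.
\<close>

definition coset_faces :: "('g, 'm) monoid_scheme \<Rightarrow> nat \<Rightarrow> (nat \<Rightarrow> 'g) \<Rightarrow> (int \<times> 'g set) set" where
  "coset_faces G n s =
     {(i, A). i \<in> {-1..int n} \<and> A \<in> lcosets\<^bsub>G\<^esub> (\<Gamma> G n s ({-1..int n} - {i}))}"

definition coset_poset :: "('g, 'm) monoid_scheme \<Rightarrow> nat \<Rightarrow> (nat \<Rightarrow> 'g) \<Rightarrow> (int \<times> 'g set) rel" where
  "coset_poset G n s =
     {((i, A), (j, B)). (i, A) \<in> coset_faces G n s \<and> (j, B) \<in> coset_faces G n s \<and> i \<le> j \<and>
        (A \<inter> B \<noteq> {} \<or>
         n = 2 \<and> i = 0 \<and> j = 1 \<and> (\<exists>g \<in> B. g \<otimes>\<^bsub>G\<^esub> s 1 \<in> A))}"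


section \<open>The mix\<close>

definition mix_generator ::
  "nat \<Rightarrow> 'a rel \<Rightarrow> 'a set \<Rightarrow> 'b rel \<Rightarrow> 'b set \<Rightarrow> nat \<Rightarrow> ('a \<Rightarrow> 'a) \<times> ('b \<Rightarrow> 'b)" where
  "mix_generator n P \<Phi> Q \<Psi> i = (\<sigma> n P \<Phi> i, \<sigma> n Q \<Psi> i)"

definition mix_group ::
  "nat \<Rightarrow> 'a rel \<Rightarrow> 'a set \<Rightarrow> 'b rel \<Rightarrow> 'b set \<Rightarrow> (('a \<Rightarrow> 'a) \<times> ('b \<Rightarrow> 'b)) monoid" where
  "mix_group n P \<Phi> Q \<Psi> =
     (rotation_group n P \<Phi> \<times>\<times> rotation_group n Q \<Psi>)
       \<lparr>carrier := generate (rotation_group n P \<Phi> \<times>\<times> rotation_group n Q \<Psi>)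
          (mix_generator n P \<Phi> Q \<Psi> ` {1..n - 1})\<rparr>"

definition mix ::
  "nat \<Rightarrow> 'a rel \<Rightarrow> 'a set \<Rightarrow> 'b rel \<Rightarrow> 'b set \<Rightarrow> (int \<times> (('a \<Rightarrow> 'a) \<times> ('b \<Rightarrow> 'b)) set) rel" where
  "mix n P \<Phi> Q \<Psi> = coset_poset (mix_group n P \<Phi> Q \<Psi>) n (mix_generator n P \<Phi> Q \<Psi>)"

end

theory Submission
  imports Defs "HOL-Number_Theory.Cong"
begin

text \<open>
  The argument is carried out on flags rather than in the groups. The i-adjacency involutions turn
  the flags of a polytope into a maniplex, the i-faces are the components after deleting colour i,
  and a maniplex is polytopal as soon as paths with colours above i and paths with colours below j
  between the same flags yield a path with colours strictly between i and j. A rotation group acts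
  freely with the two parity classes of flags as orbits, so for n at least 2 the cosets of its face
  stabilizers are the even halves of these components, and the coset poset of the mix is the poset
  of the maniplex formed by pairs of flags. For pairs, the
  path property holds in each component; to combine the two paths one only needs, in the colour
  interval strictly between i and j, to move one component while fixing the other. The rotations
  involved have indices in {2..n-2}, where coprimality lets a power of the diagonal rotation do
  this, and the parity of the flags takes care of paths of odd length.
\<close>

section \<open>Maniplexes and the path intersection property\<close>

text \<open>Two commuting structures occur throughout. The colours \<open>r c\<close> act on every
  flag, even in a chiral polytope, where no single reflection is an automorphism. Group elements
  commute with all colours, but the rotation \<open>s i\<close> is tied to the two steps
  \<open>i - 1\<close>, \<open>i\<close> only at the base flag. The range of the coprimality
  hypothesis comes from the path property: the rotation with index k uses the colours k - 1 and k,
  and both must lie strictly between i and j, where i is at least 0 and j at most n - 1. Hence k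
  runs from 2 to n - 2. The obstacle is that a step always moves both components of a pair and flips
  both parities, so no path of pairs moves one component by a single reflection while fixing the
  other. Only products of two reflections can be isolated; that the required correction is such a
  product follows from the common change of parity. The final alternative is decided at the end and
  not inherited from the two polytopes: the mix is directly regular or chiral according to whether
  some automorphism of its poset merges the two parity classes.\<close>

inductive conn :: "(nat \<Rightarrow> 'x \<Rightarrow> 'x) \<Rightarrow> nat set \<Rightarrow> 'x \<Rightarrow> 'x \<Rightarrow> bool" for r I x where
  conn_refl: "conn r I x x"
| conn_step: "conn r I x y \<Longrightarrow> c \<in> I \<Longrightarrow> conn r I x (r c y)"

text \<open>The later path is the first premise because the induction extends that path step by
  step.\<close>

lemma conn_trans: "conn r I y z \<Longrightarrow> conn r I x y \<Longrightarrow> conn r I x z"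
  by (induction rule: conn.induct) (auto intro: conn.intros)

lemma conn_mono: "conn r I x y \<Longrightarrow> I \<subseteq> J \<Longrightarrow> conn r J x y"
  by (induction rule: conn.induct) (auto intro: conn.intros)

lemma conn_empty: "conn r {} x y \<Longrightarrow> y = x"
  by (induction rule: conn.induct) auto

lemma conn_single: "c \<in> I \<Longrightarrow> conn r I x (r c x)"
  by (rule conn_step[OF conn_refl])

text \<open>Split off from \<open>maniplex\<close> because the product \<open>F1 \<times> F2\<close>
  used for the mix is not connected: parity divides it.\<close>

locale flag_system =
  fixes n :: nat and F :: "'x set" and r :: "nat \<Rightarrow> 'x \<Rightarrow> 'x"
  assumes r_closed: "c < n \<Longrightarrow> x \<in> F \<Longrightarrow> r c x \<in> F"
    and r_invol: "c < n \<Longrightarrow> x \<in> F \<Longrightarrow> r c (r c x) = x"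
begin

lemma conn_closed: "conn r I x y \<Longrightarrow> I \<subseteq> {..<n} \<Longrightarrow> x \<in> F \<Longrightarrow> y \<in> F"
  by (induction rule: conn.induct) (auto intro: r_closed)

lemma conn_sym: "conn r I x y \<Longrightarrow> I \<subseteq> {..<n} \<Longrightarrow> x \<in> F \<Longrightarrow> conn r I y x"
proof (induction rule: conn.induct)
  case (conn_step y c)
  then have y: "y \<in> F" and c: "c < n" using conn_closed by auto
  have "conn r I (r c y) (r c (r c y))" using conn_step by (intro conn_single)
  then have "conn r I (r c y) y" unfolding r_invol[OF c y] .
  moreover have "conn r I y x" using conn_step by simp
  ultimately show ?case by (rule conn_trans[rotated])
qed (rule conn_refl)

end

locale maniplex = flag_system +
  assumes r_comm: "c + 1 < d \<Longrightarrow> d < n \<Longrightarrow> x \<in> F \<Longrightarrow> r c (r d x) = r d (r c x)"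
    and connected: "x \<in> F \<Longrightarrow> y \<in> F \<Longrightarrow> conn r {..<n} x y"
    and r_no_fixpoint: "c < n \<Longrightarrow> x \<in> F \<Longrightarrow> r c x \<noteq> x"
begin

text \<open>Reflections with distant colours commute, so the steps of a path can be sorted: colours
  of \<open>I\<close> before colours of \<open>J\<close>.\<close>

lemma conn_split:
  assumes "conn r K x y" "K \<subseteq> I \<union> J" "I \<subseteq> {..<n}" "J \<subseteq> {..<n}" "x \<in> F"
    and far: "\<And>c d. c \<in> I \<Longrightarrow> d \<in> J \<Longrightarrow> c + 1 < d \<or> d + 1 < c"
  shows "\<exists>z. conn r I x z \<and> conn r J z y"
  using assms(1)
proof (induction rule: conn.induct)
  case conn_refl
  then show ?case using conn.conn_refl[of r I x] conn.conn_refl[of r J x] by auto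
next
  case (conn_step y c)
  then obtain z where z: "conn r I x z" "conn r J z y" by blast
  have zX: "z \<in> F" using conn_closed[OF z(1)] assms by blast
  show ?case
  proof (cases "c \<in> J")
    case True
    then show ?thesis using conn.conn_step[OF z(2)] z(1) by blast
  next
    case False
    then have c: "c \<in> I" using conn_step assms by auto
    \<comment> \<open>The new step \<open>c\<close> is carried back along the whole
      \<open>J\<close>-path to its start \<open>z\<close>, where it prolongs the
      \<open>I\<close>-path.\<close>
    have "conn r J (r c z) (r c y)" using z(2)
    proof (induction rule: conn.induct)
      case (conn_step u d)
      have "u \<in> F" using conn_closed[OF conn_step(1)] assms zX by auto
      then have "r c (r d u) = r d (r c u)"
        using far[OF c conn_step(2)] r_comm assms(3,4) c conn_step(2)
        by (metis lessThan_iff subsetD)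
      then show ?case using conn_step conn.conn_step[of r J "r c z" "r c u" d] by simp
    qed (rule conn_refl)
    with conn.conn_step[OF z(1) c] show ?thesis by blast
  qed
qed

end

text \<open>The assumption is the weak path intersection property of Garza-Vargas and Hubard.\<close>

locale polytopal_maniplex = maniplex +
  assumes path_intersection:
    "i < j \<Longrightarrow> j < n \<Longrightarrow> x \<in> F \<Longrightarrow> conn r {i<..<n} x y \<Longrightarrow> conn r {..<j} x y
      \<Longrightarrow> conn r {i<..<j} x y"
begin

text \<open>The path axiom controls two ranks at a time; this is its version for any set of ranks.
  The induction adds a new largest rank \<open>j\<close>, and only the previous largest rank
  \<open>i\<close> has to be compared with it.\<close>

lemma conn_avoiding:
  assumes "finite S" "S \<subseteq> {..<n}" "x \<in> F" "y \<in> F"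
    and "\<And>i. i \<in> S \<Longrightarrow> conn r ({..<n} - {i}) x y"
  shows "conn r ({..<n} - S) x y"
  using assms
proof (induction rule: finite_linorder_max_induct)
  case empty
  then show ?case using connected by simp
next
  case (insert j S)
  have IH: "conn r ({..<n} - S) x y" using insert by simp
  have j: "j < n" and jy: "conn r ({..<n} - {j}) x y" using insert by auto
  show ?case
  proof (cases "S = {}")
    case True
    then show ?thesis using jy by simp
  next
    case False
    define i where "i = Max S"
    have i: "i \<in> S" "\<And>k. k \<in> S \<Longrightarrow> k \<le> i" using False insert(1) by (auto simp: i_def)
    have ij: "i < j" using insert i by auto
    define T where "T = {..<i} - S"
    \<comment> \<open>A path that omits \<open>i\<close> separates into colours below and above
      \<open>i\<close>. The lower part avoids \<open>j\<close> already, which leaves the passage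
      from \<open>z\<close> to \<open>y\<close>.\<close>
    have "\<exists>z. conn r T x z \<and> conn r {i<..<n} z y"
    proof (rule conn_split[OF IH])
      show "{..<n} - S \<subseteq> T \<union> {i<..<n}" using i(1) by (auto simp: T_def) (metis linorder_neqE_nat)
      fix c d assume "c \<in> T" "d \<in> {i<..<n}"
      then show "c + 1 < d \<or> d + 1 < c" by (auto simp: T_def)
    qed (use ij j insert in \<open>auto simp: T_def\<close>)
    then obtain z where z: "conn r T x z" "conn r {i<..<n} z y" by blast
    have T: "T \<subseteq> {..<n} - insert j S" using ij j by (auto simp: T_def)
    have zX: "z \<in> F" using conn_closed[OF z(1)] T insert by blast
    have "conn r ({..<n} - {j}) x z" using z(1) by (rule conn_mono) (use T in auto)
    then have "conn r ({..<n} - {j}) z x" by (rule conn_sym) (use insert in auto)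
    then have "conn r ({..<n} - {j}) z y" by (rule conn_trans[OF jy])
    \<comment> \<open>Cutting this passage at \<open>j\<close> gives a flag \<open>u\<close> that is
      joined to \<open>z\<close> both below \<open>j\<close> and above \<open>i\<close>, as
      \<open>path_intersection\<close> requires.\<close>
    then have "\<exists>u. conn r {..<j} z u \<and> conn r {j<..<n} u y"
    proof (rule conn_split)
      fix c d assume "c \<in> {..<j}" "d \<in> {j<..<n}"
      then show "c + 1 < d \<or> d + 1 < c" by auto
    qed (use j zX in auto)
    then obtain u where u: "conn r {..<j} z u" "conn r {j<..<n} u y" by blast
    have uX: "u \<in> F" using conn_closed[OF u(1)] j zX by auto
    have "conn r {i<..<n} u y" by (rule conn_mono[OF u(2)]) (use ij in auto)
    then have "conn r {i<..<n} y u" by (rule conn_sym) (use uX in auto)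
    then have "conn r {i<..<n} z u" by (rule conn_trans[OF _ z(2)])
    then have "conn r {i<..<j} z u" using path_intersection ij j zX u(1) by blast
    then have "conn r ({..<n} - insert j S) z u"
    proof (rule conn_mono)
      show "{i<..<j} \<subseteq> {..<n} - insert j S" using j by (auto dest: i(2))
    qed
    moreover have "conn r ({..<n} - insert j S) x z"
      by (rule conn_mono[OF z(1) T])
    moreover have "conn r ({..<n} - insert j S) u y"
    proof (rule conn_mono[OF u(2)])
      show "{j<..<n} \<subseteq> {..<n} - insert j S" using ij by (auto dest: i(2))
    qed
    ultimately show ?thesis by (meson conn_trans)
  qed
qed

end

section \<open>The poset of a polytopal maniplex\<close>

text \<open>These are the steps that keep the \<open>i\<close>-face. Ranks are integers so that -1
  and \<open>n\<close> fit in; for these two no colour is excluded.\<close>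

definition other_ranks :: "nat \<Rightarrow> int \<Rightarrow> nat set" where
  "other_ranks n i = {c. c < n \<and> int c \<noteq> i}"

lemma other_ranks_subset [simp]: "other_ranks n i \<subseteq> {..<n}"
  by (auto simp: other_ranks_def)

lemma other_ranks_nat [simp]: "other_ranks n (int c) = {..<n} - {c}"
  by (auto simp: other_ranks_def)

lemma other_ranks_out: "i < 0 \<or> int n \<le> i \<Longrightarrow> other_ranks n i = {..<n}"
  by (auto simp: other_ranks_def)

text \<open>Faces are arbitrary labels of the components after deleting one colour. The
  combinatorics is thus done once and later applied with cosets of face stabilizers as
  labels.\<close>

locale face_poset = polytopal_maniplex n F r
  for n and F :: "'x set" and r +
  fixes fc :: "int \<Rightarrow> 'x \<Rightarrow> 'f"
  assumes fc_eq_iff: "x \<in> F \<Longrightarrow> y \<in> F \<Longrightarrow> i \<in> {-1..int n} \<Longrightarrow> j \<in> {-1..int n} \<Longrightarrow>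
      fc i x = fc j y \<longleftrightarrow> i = j \<and> conn r (other_ranks n i) x y"
    and nonempty: "F \<noteq> {}"
begin

definition face_order :: "'f rel" where
  "face_order = {(fc i x, fc j x) | i j x. x \<in> F \<and> -1 \<le> i \<and> i \<le> j \<and> j \<le> int n}"

definition flag_of :: "'x \<Rightarrow> 'f set" where
  "flag_of x = (\<lambda>i. fc i x) ` {-1..int n}"

lemma fc_eqD:
  assumes "fc i x = fc j y" "x \<in> F" "y \<in> F" "-1 \<le> i" "i \<le> int n" "-1 \<le> j" "j \<le> int n"
  shows "i = j" "conn r (other_ranks n i) x y"
  using assms fc_eq_iff[of x y i j] by auto

lemma fc_eqI:
  assumes "conn r (other_ranks n i) x y" "x \<in> F" "y \<in> F" "-1 \<le> i" "i \<le> int n"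
  shows "fc i x = fc i y"
  using assms fc_eq_iff[of x y i i] by auto

lemma fc_step:
  assumes "c < n" "int c \<noteq> i" "x \<in> F" "-1 \<le> i" "i \<le> int n"
  shows "fc i (r c x) = fc i x"
proof -
  have "conn r (other_ranks n i) x (r c x)"
    by (rule conn_single) (use assms in \<open>auto simp: other_ranks_def\<close>)
  then show ?thesis using fc_eqI r_closed assms by metis
qed

lemma fc_extreme:
  assumes "x \<in> F" "y \<in> F"
  shows "fc (-1) x = fc (-1) y" "fc (int n) x = fc (int n) y"
  using fc_eqI[of "-1" x y] fc_eqI[of "int n" x y] assms connected
  by (auto simp: other_ranks_out simp del: other_ranks_nat)

text \<open>The path that fixes the common \<open>j\<close>-face is sorted into colours above
  \<open>j\<close>, then below \<open>j\<close>; the flag in between has the lower faces of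
  \<open>x\<close> and the upper faces of \<open>y\<close>. As incidence means lying in a common
  flag, this is what makes it transitive.\<close>

lemma glue:
  assumes "x \<in> F" "y \<in> F" "fc j x = fc j y" "-1 \<le> j" "j \<le> int n"
  shows "\<exists>z\<in>F. (\<forall>i. -1 \<le> i \<and> i \<le> j \<longrightarrow> fc i z = fc i x) \<and> (\<forall>i. j \<le> i \<and> i \<le> int n \<longrightarrow> fc i z = fc i y)"
proof -
  have "conn r (other_ranks n j) x y" using fc_eqD assms by metis
  then have "\<exists>z. conn r {c. j < int c \<and> c < n} x z \<and> conn r {c. int c < j \<and> c < n} z y"
    by (rule conn_split) (use assms in \<open>auto simp: other_ranks_def\<close>)
  then obtain z where z: "conn r {c. j < int c \<and> c < n} x z" "conn r {c. int c < j \<and> c < n} z y"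
    by blast
  have zF: "z \<in> F" by (rule conn_closed[OF z(1)]) (use assms in auto)
  have "fc i z = fc i x" if i: "-1 \<le> i" "i \<le> j" for i
  proof -
    have "conn r (other_ranks n i) x z"
      by (rule conn_mono[OF z(1)]) (use i in \<open>auto simp: other_ranks_def\<close>)
    then show ?thesis using fc_eqI[of i x z] i assms zF by auto
  qed
  moreover have "fc i z = fc i y" if i: "j \<le> i" "i \<le> int n" for i
  proof -
    have "conn r (other_ranks n i) z y"
      by (rule conn_mono[OF z(2)]) (use i in \<open>auto simp: other_ranks_def\<close>)
    then show ?thesis using fc_eqI[of i z y] i assms zF by auto
  qed
  ultimately show ?thesis using zF by blast
qed

lemma face_orderI: "x \<in> F \<Longrightarrow> -1 \<le> i \<Longrightarrow> i \<le> j \<Longrightarrow> j \<le> int n \<Longrightarrow> (fc i x, fc j x) \<in> face_order"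
  by (auto simp: face_order_def)

lemma face_orderE:
  assumes "(a, b) \<in> face_order"
  obtains x i j where "x \<in> F" "-1 \<le> i" "i \<le> j" "j \<le> int n" "a = fc i x" "b = fc j x"
  using assms by (auto simp: face_order_def)

lemma face_order_rank:
  assumes "(fc i x, fc j y) \<in> face_order" "x \<in> F" "y \<in> F" "i \<in> {-1..int n}" "j \<in> {-1..int n}"
  shows "i \<le> j"
proof -
  obtain z i' j' where z: "z \<in> F" "-1 \<le> i'" "i' \<le> j'" "j' \<le> int n" "fc i x = fc i' z" "fc j y = fc j' z"
    using assms(1) by (rule face_orderE)
  then have "i = i'" "j = j'" using fc_eqD(1) assms by auto
  then show ?thesis using z by simp
qed

lemma Field_face_order: "Field face_order = {fc i x | i x. x \<in> F \<and> i \<in> {-1..int n}}"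
proof
  show "Field face_order \<subseteq> {fc i x | i x. x \<in> F \<and> i \<in> {-1..int n}}"
    unfolding Field_def face_order_def by fastforce
  show "{fc i x | i x. x \<in> F \<and> i \<in> {-1..int n}} \<subseteq> Field face_order"
  proof safe
    fix i x assume "x \<in> F" "i \<in> {-1..int n}"
    then have "(fc i x, fc i x) \<in> face_order" by (intro face_orderI) auto
    then show "fc i x \<in> Field face_order" by (rule FieldI1)
  qed
qed

lemma face_order_refl: "a \<in> Field face_order \<Longrightarrow> (a, a) \<in> face_order"
  by (auto simp: Field_face_order intro: face_orderI)

lemma face_order_antisym:
  assumes "(a, b) \<in> face_order" "(b, a) \<in> face_order"
  shows "a = b"
proof -
  obtain x i j where x: "x \<in> F" "-1 \<le> i" "i \<le> j" "j \<le> int n" "a = fc i x" "b = fc j x"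
    using assms(1) by (rule face_orderE)
  then have "j \<le> i" using face_order_rank assms(2) by auto
  then show ?thesis using x by simp
qed

lemma face_order_trans:
  assumes "(a, b) \<in> face_order" "(b, d) \<in> face_order"
  shows "(a, d) \<in> face_order"
proof -
  obtain x i j where x: "x \<in> F" "-1 \<le> i" "i \<le> j" "j \<le> int n" "a = fc i x" "b = fc j x"
    using assms(1) by (rule face_orderE)
  obtain y j' k where y: "y \<in> F" "-1 \<le> j'" "j' \<le> k" "k \<le> int n" "b = fc j' y" "d = fc k y"
    using assms(2) by (rule face_orderE)
  have "j = j'" using fc_eqD(1)[of j x j' y] x y by auto
  then obtain z where "z \<in> F" "fc i z = fc i x" "fc k z = fc k y"
    using glue[of x y j] x y by auto
  then show ?thesis using face_orderI[of z i k] x y \<open>j = j'\<close> by auto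
qed

lemma Partial_order_face_order: "Partial_order face_order"
proof -
  have "refl_on (Field face_order) face_order"
    by (rule refl_onI) (rule face_order_refl)
  moreover have "trans face_order" using face_order_trans by (blast intro: transI)
  moreover have "antisym face_order" using face_order_antisym by (blast intro: antisymI)
  moreover have "face_order \<subseteq> Field face_order \<times> Field face_order" by (auto simp: Field_def)
  ultimately show ?thesis by (simp add: partial_order_on_def preorder_on_def)
qed

text \<open>Ranks are added in increasing order: a flag \<open>x\<close> through the earlier faces
  and a flag \<open>y\<close> through the top two are glued at the second highest rank.\<close>

lemma compatible_choice:
  assumes "finite A" "A \<subseteq> {-1..int n}"
    and "\<And>i j. i \<in> A \<Longrightarrow> j \<in> A \<Longrightarrow> i \<le> j \<Longrightarrow> (f i, f j) \<in> face_order"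
    and "\<And>i. i \<in> A \<Longrightarrow> \<exists>x\<in>F. f i = fc i x"
  shows "\<exists>x\<in>F. \<forall>i\<in>A. f i = fc i x"
  using assms
proof (induction rule: finite_linorder_max_induct)
  case empty
  then show ?case using nonempty by auto
next
  case (insert b A)
  show ?case
  proof (cases "A = {}")
    case True
    then show ?thesis using insert.prems by auto
  next
    case False
    obtain x where x: "x \<in> F" "\<forall>i\<in>A. f i = fc i x" using insert by force
    define j where "j = Max A"
    have j: "j \<in> A" "\<And>k. k \<in> A \<Longrightarrow> k \<le> j" using False insert(1) by (auto simp: j_def)
    have jb: "j \<le> b" "-1 \<le> j" "b \<le> int n"
      using insert(2) insert.prems(1) j(1) by (auto simp: less_imp_le)
    have "(f j, f b) \<in> face_order" using insert j jb by auto
    then obtain y j' k where y: "y \<in> F" "-1 \<le> j'" "j' \<le> k" "k \<le> int n" "f j = fc j' y" "f b = fc k y"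
      by (rule face_orderE)
    have j': "j = j'" using fc_eqD(1)[of j x j' y] x y j jb by auto
    obtain w where w: "w \<in> F" "f b = fc b w" using insert.prems(3)[of b] by blast
    have k: "b = k" using fc_eqD(1)[of b w k y] w y jb by auto
    obtain z where z: "z \<in> F" "\<And>i. -1 \<le> i \<and> i \<le> j \<Longrightarrow> fc i z = fc i x"
      "\<And>i. j \<le> i \<and> i \<le> int n \<Longrightarrow> fc i z = fc i y"
      using glue[of x y j] x y j j' jb by auto
    have "f i = fc i z" if "i \<in> insert b A" for i
    proof (cases "i = b")
      case True
      then show ?thesis using z(3)[of b] jb y k by simp
    next
      case False
      then have i: "i \<in> A" "-1 \<le> i" using that insert.prems by auto
      then show ?thesis using x z(2)[of i] j by simp
    qed
    then show ?thesis using z(1) by blast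
  qed
qed

lemma flag_of_chain: "x \<in> F \<Longrightarrow> flag_of x \<in> Chains face_order"
  unfolding Chains_def flag_of_def
  by (auto intro!: face_orderI)

lemma chain_subset_flag_of:
  assumes "C \<in> Chains face_order"
  shows "\<exists>x\<in>F. C \<subseteq> flag_of x"
proof -
  have C: "(a, b) \<in> face_order \<or> (b, a) \<in> face_order" if "a \<in> C" "b \<in> C" for a b
    using assms that by (auto simp: Chains_def)
  have CF: "\<exists>i x. x \<in> F \<and> i \<in> {-1..int n} \<and> a = fc i x" if "a \<in> C" for a
  proof -
    have "a \<in> Field face_order" using C[OF that that] by (auto simp: Field_def)
    then show ?thesis by (auto simp: Field_face_order)
  qed
  define A where "A = {i \<in> {-1..int n}. \<exists>a\<in>C. \<exists>x\<in>F. a = fc i x}"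
  \<comment> \<open>One face of \<open>C\<close> is chosen for each rank that occurs. That it is the
    only one follows at the end, since comparable faces of equal rank coincide.\<close>
  define f where "f i = (SOME a. a \<in> C \<and> (\<exists>x\<in>F. a = fc i x))" for i
  have f: "f i \<in> C \<and> (\<exists>x\<in>F. f i = fc i x)" if "i \<in> A" for i
    unfolding f_def by (rule someI_ex) (use that in \<open>auto simp: A_def\<close>)
  have "\<exists>x\<in>F. \<forall>i\<in>A. f i = fc i x"
  proof (rule compatible_choice)
    show "A \<subseteq> {-1..int n}" by (auto simp: A_def)
    then show "finite A" by (rule finite_subset) simp
    fix i j assume ij: "i \<in> A" "j \<in> A" "i \<le> j"
    obtain x where x: "x \<in> F" "f i = fc i x" using f ij by blast
    obtain y where y: "y \<in> F" "f j = fc j y" using f ij by blast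
    have rng: "i \<in> {-1..int n}" "j \<in> {-1..int n}" using ij by (auto simp: A_def)
    show "(f i, f j) \<in> face_order"
    proof (cases "(f i, f j) \<in> face_order")
      case False
      then have ji: "(f j, f i) \<in> face_order" using C f ij by blast
      then have "j \<le> i" using face_order_rank[of j y i x] x y rng by auto
      then have "i = j" using ij by simp
      then show ?thesis using ji by simp
    qed
  qed (use f in blast)
  then obtain x where x: "x \<in> F" "\<And>i. i \<in> A \<Longrightarrow> f i = fc i x" by blast
  have "a \<in> flag_of x" if a: "a \<in> C" for a
  proof -
    obtain i y where y: "y \<in> F" "i \<in> {-1..int n}" "a = fc i y" using CF a by blast
    then have i: "i \<in> A" using a by (auto simp: A_def)
    obtain w where w: "w \<in> F" "f i = fc i w" using f i by blast
    have "(a, f i) \<in> face_order \<or> (f i, a) \<in> face_order" using C a f[OF i] by blast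
    then have "a = f i"
    proof
      assume "(a, f i) \<in> face_order"
      then obtain z k l where z: "z \<in> F" "-1 \<le> k" "k \<le> l" "l \<le> int n" "a = fc k z" "f i = fc l z"
        by (rule face_orderE)
      then have "i = k" "i = l" using fc_eqD(1)[of i y k z] fc_eqD(1)[of i w l z] y w by auto
      then show ?thesis using z by simp
    next
      assume "(f i, a) \<in> face_order"
      then obtain z k l where z: "z \<in> F" "-1 \<le> k" "k \<le> l" "l \<le> int n" "f i = fc k z" "a = fc l z"
        by (rule face_orderE)
      then have "i = k" "i = l" using fc_eqD(1)[of i w k z] fc_eqD(1)[of i y l z] y w by auto
      then show ?thesis using z by simp
    qed
    then show ?thesis using x(2)[OF i] y(2) by (auto simp: flag_of_def)
  qed
  then show ?thesis using x(1) by blast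
qed

lemma flag_of_eqD:
  assumes "flag_of x \<subseteq> flag_of y" "x \<in> F" "y \<in> F" "-1 \<le> i" "i \<le> int n"
  shows "fc i x = fc i y"
proof -
  have "fc i x \<in> flag_of y" using assms by (auto simp: flag_of_def)
  then obtain j where j: "j \<in> {-1..int n}" "fc i x = fc j y" by (auto simp: flag_of_def)
  then show ?thesis using fc_eqD(1)[of i x j y] assms by auto
qed

text \<open>This is \<open>conn_avoiding\<close> in terms of faces. Path intersection enters the
  poset through it alone: for injectivity of \<open>flag_of\<close>, the diamond condition and
  strong flag-connectivity.\<close>

lemma conn_of_common_faces:
  assumes "x \<in> F" "y \<in> F" "S \<subseteq> {..<n}" "\<And>i. i \<in> S \<Longrightarrow> fc (int i) x = fc (int i) y"
  shows "conn r ({..<n} - S) x y"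
proof (rule conn_avoiding)
  show "finite S" using assms(3) finite_subset by blast
  fix i assume "i \<in> S"
  then show "conn r ({..<n} - {i}) x y" using fc_eqD(2)[of "int i" x "int i" y] assms by auto
qed (use assms in auto)

text \<open>If all faces agree, the path joining the flags has no colour left. Inclusion in place of
  equality is what maximality among chains calls for.\<close>

lemma flag_of_inj: "flag_of x \<subseteq> flag_of y \<Longrightarrow> x \<in> F \<Longrightarrow> y \<in> F \<Longrightarrow> x = y"
proof -
  assume *: "flag_of x \<subseteq> flag_of y" "x \<in> F" "y \<in> F"
  have "conn r ({..<n} - {..<n}) x y"
    by (rule conn_of_common_faces) (use * flag_of_eqD in auto)
  then show ?thesis using conn_empty[of r x y] by simp
qed

lemma flags_face_order: "flags face_order = flag_of ` F"
proof -
  have max: "\<Psi> = flag_of x" if x: "x \<in> F" and "\<Psi> \<in> Chains face_order" "flag_of x \<subseteq> \<Psi>" for \<Psi> x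
  proof -
    obtain y where y: "y \<in> F" "\<Psi> \<subseteq> flag_of y" using chain_subset_flag_of \<open>\<Psi> \<in> _\<close> by blast
    then have "x = y" using flag_of_inj[of x y] that by auto
    then show ?thesis using y that by blast
  qed
  show ?thesis
  proof
    show "flag_of ` F \<subseteq> flags face_order" unfolding flags_def using flag_of_chain max by blast
    show "flags face_order \<subseteq> flag_of ` F"
    proof
      fix C assume C: "C \<in> flags face_order"
      then have "C \<in> Chains face_order" by (simp add: flags_def)
      then obtain x where "x \<in> F" "C \<subseteq> flag_of x"
        using chain_subset_flag_of by blast
      then have "flag_of x = C" using C flag_of_chain unfolding flags_def by blast
      then show "C \<in> flag_of ` F" using \<open>x \<in> F\<close> by blast
    qed
  qed
qed

section \<open>Ranks and adjacency in the face poset, and the polytope axioms\<close>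

lemma inj_fc: "x \<in> F \<Longrightarrow> inj_on (\<lambda>i. fc i x) {-1..int n}"
  using fc_eqD(1) by (auto simp: inj_on_def)

lemma card_flag_of: "x \<in> F \<Longrightarrow> finite (flag_of x) \<and> card (flag_of x) = n + 2"
  unfolding flag_of_def using inj_fc card_image by fastforce

lemma face_rank_fc:
  assumes "x \<in> F" "-1 \<le> i" "i \<le> int n"
  shows "face_rank face_order (fc i x) = i"
proof -
  have card: "int (card {a \<in> flag_of y. (a, fc i x) \<in> face_order}) - 2 = i"
    if y: "y \<in> F" "fc i x \<in> flag_of y" for y
  proof -
    obtain j where j: "j \<in> {-1..int n}" "fc i x = fc j y" using y by (auto simp: flag_of_def)
    then have xy: "fc i x = fc i y" using fc_eqD(1)[of i x j y] y assms by auto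
    have "{a \<in> flag_of y. (a, fc i y) \<in> face_order} = (\<lambda>k. fc k y) ` {-1..i}"
      using y assms face_order_rank[of _ y i y] by (auto simp: flag_of_def intro: face_orderI)
    moreover have "card ((\<lambda>k. fc k y) ` {-1..i}) = card {-1..i}"
      by (rule card_image, rule inj_on_subset[OF inj_fc[OF y(1)]]) (use assms in auto)
    ultimately show ?thesis using assms by (simp add: xy)
  qed
  have x: "fc i x \<in> flag_of x" using assms by (auto simp: flag_of_def)
  show ?thesis unfolding face_rank_def flags_face_order
    by (rule the_equality) (use card assms x in auto)
qed

lemma adjacent_flag_of:
  assumes "x \<in> F" "c < n"
  shows "adjacent face_order (int c) (flag_of x) (flag_of (r c x))"
proof -
  have rx: "r c x \<in> F" "r c x \<noteq> x" using r_closed r_no_fixpoint assms by auto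
  then have "flag_of x \<noteq> flag_of (r c x)" using flag_of_inj[of x "r c x"] assms by auto
  moreover have "{a \<in> flag_of x. face_rank face_order a \<noteq> int c} = (\<lambda>i. fc i x) ` ({-1..int n} - {int c})"
    if "x \<in> F" for x
    using face_rank_fc that by (auto simp: flag_of_def)
  moreover have "(\<lambda>i. fc i x) ` ({-1..int n} - {int c}) = (\<lambda>i. fc i (r c x)) ` ({-1..int n} - {int c})"
    by (rule image_cong) (use assms fc_step[of c _ x] in auto)
  ultimately show ?thesis using assms rx unfolding adjacent_def flags_face_order by auto
qed

text \<open>A flag with the same faces of ranks \<open>i\<close> and \<open>i + 2\<close> is reached
  by a path omitting these colours. Colour \<open>c = i + 1\<close> swaps two faces of rank
  \<open>i + 1\<close>; every other allowed colour commutes with \<open>c\<close> and leaves that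
  rank alone, so only two faces occur.\<close>

lemma diamond:
  assumes "(a, b) \<in> face_order" "face_rank face_order b = face_rank face_order a + 2"
  shows "card {z. z \<noteq> a \<and> z \<noteq> b \<and> (a, z) \<in> face_order \<and> (z, b) \<in> face_order} = 2"
proof -
  obtain x i j where x: "x \<in> F" "-1 \<le> i" "i \<le> j" "j \<le> int n" "a = fc i x" "b = fc j x"
    using assms(1) by (rule face_orderE)
  have j: "j = i + 2" using assms(2) face_rank_fc x by auto
  define c where "c = nat (i + 1)"
  have c: "int c = i + 1" "c < n" using x j by (auto simp: c_def)
  have rx: "r c x \<in> F" "r c x \<noteq> x" using r_closed r_no_fixpoint x c by auto
  have swap: "fc (i + 1) u \<in> {fc (i + 1) x, fc (i + 1) (r c x)}"
    if u: "u \<in> F" "fc i u = fc i x" "fc j u = fc j x" for u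
  proof -
    \<comment> \<open>The bound \<open>k < n\<close> drops \<open>j = n\<close>, and
      \<open>i = -1\<close> matches no natural number; the extreme ranks impose no
      condition.\<close>
    define S where "S = {k. k < n \<and> (int k = i \<or> int k = j)}"
    have "conn r ({..<n} - S) x u"
      by (rule conn_of_common_faces) (use x u in \<open>auto simp: S_def\<close>)
    \<comment> \<open>The invariant also records the face of \<open>r c u\<close>, since a step of
      colour \<open>c\<close> exchanges the two.\<close>
    then have "(fc (i+1) u = fc (i+1) x \<and> fc (i+1) (r c u) = fc (i+1) (r c x) \<or>
       fc (i+1) u = fc (i+1) (r c x) \<and> fc (i+1) (r c u) = fc (i+1) x) \<and> u \<in> F"
    proof (induction rule: conn.induct)
      case conn_refl
      then show ?case using x by simp
    next
      case (conn_step u d)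
      then have u: "u \<in> F" and d: "d < n" "d \<notin> S" by auto
      show ?case
      proof (cases "d = c")
        case True
        then show ?thesis using conn_step u c r_closed r_invol by auto
      next
        case False
        then have far: "c + 1 < d \<or> d + 1 < c" using c d j by (auto simp: S_def)
        then have "r c (r d u) = r d (r c u)" using r_comm[of c d u] r_comm[of d c u] c d u by metis
        moreover have "fc (i+1) (r d v) = fc (i+1) v" if "v \<in> F" for v
          by (rule fc_step) (use d that False c x in auto)
        ultimately show ?thesis using conn_step.IH u c d r_closed by auto
      qed
    qed
    then show ?thesis by auto
  qed
  have "{z. z \<noteq> a \<and> z \<noteq> b \<and> (a, z) \<in> face_order \<and> (z, b) \<in> face_order}
      = {fc (i + 1) x, fc (i + 1) (r c x)}" (is "?L = ?R")
  proof
    show "?L \<subseteq> ?R"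
    proof
      fix z assume "z \<in> ?L"
      then have z: "z \<noteq> a" "z \<noteq> b" "(a, z) \<in> face_order" "(z, b) \<in> face_order" by auto
      obtain u i' k where u: "u \<in> F" "-1 \<le> i'" "i' \<le> k" "k \<le> int n" "a = fc i' u" "z = fc k u"
        using z(3) by (rule face_orderE)
      obtain v k' j' where v: "v \<in> F" "-1 \<le> k'" "k' \<le> j'" "j' \<le> int n" "z = fc k' v" "b = fc j' v"
        using z(4) by (rule face_orderE)
      have eqs: "i = i'" "j = j'" "k = k'"
        using fc_eqD(1)[of i x i' u] fc_eqD(1)[of j x j' v] fc_eqD(1)[of k u k' v] x u v by auto
      have "k \<noteq> i" "k \<noteq> j" using z(1,2) u(5,6) v(5,6) eqs by auto
      then have k: "k = i + 1" using eqs u(3) v(3) j by linarith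
      obtain w where w: "w \<in> F" "\<And>i. -1 \<le> i \<and> i \<le> k \<Longrightarrow> fc i w = fc i u"
        "\<And>i. k \<le> i \<and> i \<le> int n \<Longrightarrow> fc i w = fc i v"
        using glue[of u v k] u v eqs by auto
      have "fc i w = fc i x" "fc j w = fc j x" "z = fc (i + 1) w"
        using w u v eqs x k by auto
      then show "z \<in> ?R" using swap w(1) by auto
    qed
    have mid: "fc (i + 1) u \<in> ?L" if u: "u \<in> F" "fc i u = a" "fc j u = b" for u
    proof -
      have "fc (i + 1) u \<noteq> a" "fc (i + 1) u \<noteq> b"
        using fc_eqD(1)[of "i+1" u i u] fc_eqD(1)[of "i+1" u j u] u x j by auto
      moreover have "(fc i u, fc (i+1) u) \<in> face_order" "(fc (i+1) u, fc j u) \<in> face_order"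
        using face_orderI[of u i "i + 1"] face_orderI[of u "i + 1" j] u(1) x j by auto
      ultimately show ?thesis using u by simp
    qed
    have "fc i (r c x) = a" "fc j (r c x) = b"
      using fc_step[of c _ x] c x j by auto
    then show "?R \<subseteq> ?L" using mid[of x] mid[of "r c x"] x rx by auto
  qed
  moreover have "fc (i + 1) x \<noteq> fc (i + 1) (r c x)"
  proof
    assume eq: "fc (i + 1) x = fc (i + 1) (r c x)"
    have "fc k x = fc k (r c x)" if "k \<in> {-1..int n}" for k
      using fc_step[of c k x] eq c x that by (cases "k = i + 1") auto
    then have "flag_of x \<subseteq> flag_of (r c x)" by (auto simp: flag_of_def)
    then show False using flag_of_inj rx x by metis
  qed
  ultimately show ?thesis by simp
qed

text \<open>A path avoiding the ranks of the common faces never moves a common face, hence all flags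
  on it contain the intersection.\<close>

lemma strongly_connected: "strongly_flag_connected face_order"
  unfolding strongly_flag_connected_def flags_face_order
proof safe
  fix x y assume xy: "x \<in> F" "y \<in> F"
  define S where "S = {i. i < n \<and> fc (int i) x = fc (int i) y}"
  let ?Z = "flag_of x \<inter> flag_of y"
  let ?R = "{(A, B). (\<exists>i. adjacent face_order i A B) \<and> ?Z \<subseteq> A \<and> ?Z \<subseteq> B}"
  have Z: "\<exists>i\<in>{-1..int n}. a = fc i x \<and> fc i x = fc i y" if "a \<in> ?Z" for a
  proof -
    obtain i j where ij: "i \<in> {-1..int n}" "j \<in> {-1..int n}" "a = fc i x" "a = fc j y"
      using \<open>a \<in> ?Z\<close> by (auto simp: flag_of_def)
    then have "i = j" using fc_eqD(1)[of i x j y] xy by auto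
    then show ?thesis using ij by auto
  qed
  have "conn r ({..<n} - S) x y"
    by (rule conn_of_common_faces) (use xy in \<open>auto simp: S_def\<close>)
  moreover have "(flag_of x, flag_of u) \<in> ?R\<^sup>* \<and> u \<in> F \<and>
      (\<forall>i\<in>{-1..int n}. fc i x = fc i y \<longrightarrow> fc i u = fc i x)"
    if "conn r ({..<n} - S) x u" for u
    using that
  proof (induction rule: conn.induct)
    case conn_refl
    then show ?case using xy by auto
  next
    case (conn_step u c)
    then have u: "u \<in> F" "c < n" and inv: "\<forall>i\<in>{-1..int n}. fc i x = fc i y \<longrightarrow> fc i u = fc i x"
      by auto
    have ru: "r c u \<in> F" using r_closed u by simp
    have inv': "\<forall>i\<in>{-1..int n}. fc i x = fc i y \<longrightarrow> fc i (r c u) = fc i x"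
    proof safe
      fix i assume i: "i \<in> {-1..int n}" "fc i x = fc i y"
      then have "int c \<noteq> i" using conn_step(2) by (auto simp: S_def)
      then show "fc i (r c u) = fc i x" using inv i u fc_step[of c i u] by auto
    qed
    have sub: "?Z \<subseteq> flag_of v" if "\<forall>i\<in>{-1..int n}. fc i x = fc i y \<longrightarrow> fc i v = fc i x" for v
      using Z that by (force simp: flag_of_def)
    have "(flag_of u, flag_of (r c u)) \<in> ?R"
      using adjacent_flag_of[OF u] sub[OF inv] sub[OF inv'] by auto
    then show ?case using conn_step.IH ru inv' by (meson rtrancl.rtrancl_into_rtrancl)
  qed
  ultimately show "(flag_of x, flag_of y) \<in> ?R\<^sup>*" by blast
qed

lemma abstract_polytope_face_order: "abstract_polytope n face_order"
  unfolding abstract_polytope_def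
proof (intro conjI allI impI)
  obtain x0 where x0: "x0 \<in> F" using nonempty by blast
  have "(fc (-1) x0, fc i x) \<in> face_order \<and> (fc i x, fc (int n) x0) \<in> face_order"
    if "x \<in> F" "i \<in> {-1..int n}" for i x
    using face_orderI[of x "-1" i] face_orderI[of x i "int n"] fc_extreme[of x0 x] x0 that by auto
  moreover have "fc (-1) x0 \<in> Field face_order" "fc (int n) x0 \<in> Field face_order"
    using x0 unfolding Field_face_order by fastforce+
  ultimately show "\<exists>a\<in>Field face_order. \<forall>b\<in>Field face_order. (a, b) \<in> face_order"
    "\<exists>a\<in>Field face_order. \<forall>b\<in>Field face_order. (b, a) \<in> face_order"
    unfolding Field_face_order by blast+
qed (use Partial_order_face_order card_flag_of diamond strongly_connected flags_face_order in auto)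

end

section \<open>The flags of an abstract polytope\<close>

definition flag_face :: "'a rel \<Rightarrow> 'a set \<Rightarrow> int \<Rightarrow> 'a" where
  "flag_face R A i = (THE x. x \<in> A \<and> face_rank R x = i)"

locale polytope =
  fixes n :: nat and R :: "'a rel"
  assumes abstract: "abstract_polytope n R"
begin

lemma partial_order: "Partial_order R"
  using abstract by (simp add: abstract_polytope_def)

lemma reflD: "x \<in> Field R \<Longrightarrow> (x, x) \<in> R"
  using partial_order by (simp add: partial_order_on_def preorder_on_def refl_on_def)

lemma antisymD: "(x, y) \<in> R \<Longrightarrow> (y, x) \<in> R \<Longrightarrow> x = y"
  using partial_order by (auto simp: partial_order_on_def antisym_def)

lemma transD: "(x, y) \<in> R \<Longrightarrow> (y, z) \<in> R \<Longrightarrow> (x, z) \<in> R"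
  using partial_order by (meson partial_order_on_def preorder_on_def trans_def)

lemma flag_finite: "A \<in> flags R \<Longrightarrow> finite A"
  and flag_card: "A \<in> flags R \<Longrightarrow> card A = n + 2"
  using abstract by (auto simp: abstract_polytope_def)

lemma flag_chain: "A \<in> flags R \<Longrightarrow> A \<in> Chains R"
  by (simp add: flags_def)

lemma chainD: "C \<in> Chains R \<Longrightarrow> x \<in> C \<Longrightarrow> y \<in> C \<Longrightarrow> (x, y) \<in> R \<or> (y, x) \<in> R"
  by (auto simp: Chains_def)

lemma flag_total: "A \<in> flags R \<Longrightarrow> x \<in> A \<Longrightarrow> y \<in> A \<Longrightarrow> (x, y) \<in> R \<or> (y, x) \<in> R"
  using chainD flag_chain by blast

lemma flag_Field: "A \<in> flags R \<Longrightarrow> A \<subseteq> Field R"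
  using flag_total by (fastforce simp: Field_def)

text \<open>Flags are maximal chains by definition, and finiteness is given for flags only, so
  arbitrary chains are extended by Zorn's lemma.\<close>

lemma flag_extension:
  assumes C: "C \<in> Chains R"
  shows "\<exists>A\<in>flags R. C \<subseteq> A"
proof -
  let ?A = "{D \<in> Chains R. C \<subseteq> D}"
  have "\<exists>M\<in>?A. \<forall>Z\<in>?A. M \<subseteq> Z \<longrightarrow> Z = M"
  proof (rule subset_Zorn)
    fix K assume K: "subset.chain ?A K"
    show "\<exists>U\<in>?A. \<forall>Z\<in>K. Z \<subseteq> U"
    proof (cases "K = {}")
      case True
      then show ?thesis using C by auto
    next
      case False
      have "\<Union>K \<in> Chains R"
        unfolding Chains_def
      proof safe
        fix a b Z Y assume ab: "a \<in> Z" "Z \<in> K" "b \<in> Y" "Y \<in> K" "(b, a) \<notin> R"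
        have XY: "Z \<in> Chains R" "Y \<in> Chains R" using K ab by (auto simp: subset.chain_def)
        have "Z \<subseteq> Y \<or> Y \<subseteq> Z" using K ab unfolding subset.chain_def by blast
        then show "(a, b) \<in> R" using chainD XY ab by blast
      qed
      moreover have "C \<subseteq> \<Union>K" using False K unfolding subset.chain_def by blast
      ultimately show ?thesis by blast
    qed
  qed
  then obtain M where M: "M \<in> ?A" "\<forall>Z\<in>?A. M \<subseteq> Z \<longrightarrow> Z = M" by (rule bexE)
  then have "\<forall>\<Psi>\<in>Chains R. M \<subseteq> \<Psi> \<longrightarrow> \<Psi> = M" by simp (meson subset_trans)
  then show ?thesis using M(1) by (auto simp: flags_def)
qed

lemma flagI:
  assumes "C \<in> Chains R" "card C = n + 2"
  shows "C \<in> flags R"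
proof -
  obtain A where A: "A \<in> flags R" "C \<subseteq> A" using flag_extension assms by blast
  then have "C = A" using card_subset_eq[of A C] flag_finite flag_card assms by auto
  then show ?thesis using A by simp
qed

text \<open>The faces of \<open>A\<close> up to \<open>x\<close> and the faces of \<open>B\<close>
  above \<open>x\<close> form a chain, which has at most \<open>n + 2\<close> elements. Applied in
  both directions, this makes the rank independent of the flag.\<close>

lemma down_card_le:
  assumes A: "A \<in> flags R" and B: "B \<in> flags R" and x: "x \<in> A" "x \<in> B"
  shows "card {y \<in> A. (y, x) \<in> R} \<le> card {y \<in> B. (y, x) \<in> R}"
proof -
  let ?D = "{y \<in> A. (y, x) \<in> R}" and ?U = "{y \<in> B. (y, x) \<notin> R}"
  have U: "(x, y) \<in> R" if "y \<in> ?U" for y using that flag_total[OF B _ x(2)] by blast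
  have "?D \<union> ?U \<in> Chains R"
    unfolding Chains_def using U flag_total[OF A] flag_total[OF B] transD by blast
  then obtain M where M: "M \<in> flags R" "?D \<union> ?U \<subseteq> M" using flag_extension by blast
  then have "card (?D \<union> ?U) \<le> n + 2" using card_mono[OF flag_finite[OF M(1)] M(2)] flag_card[OF M(1)] by simp
  moreover have "card (?D \<union> ?U) = card ?D + card ?U"
    by (rule card_Un_disjoint) (use flag_finite A B in auto)
  moreover have "card {y \<in> B. (y, x) \<in> R} + card ?U = card B"
    by (subst card_Un_disjoint[symmetric]) (use flag_finite[OF B] in \<open>auto intro: arg_cong[where f = card]\<close>)
  ultimately show ?thesis using flag_card[OF B] by simp
qed

lemma face_rank_eq:
  assumes "A \<in> flags R" "x \<in> A"
  shows "face_rank R x = int (card {y \<in> A. (y, x) \<in> R}) - 2"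
  unfolding face_rank_def
proof (rule the_equality)
  fix k assume "\<exists>B\<in>flags R. x \<in> B \<and> k = int (card {y \<in> B. (y, x) \<in> R}) - 2"
  then obtain B where B: "B \<in> flags R" "x \<in> B" "k = int (card {y \<in> B. (y, x) \<in> R}) - 2" by blast
  then have "card {y \<in> B. (y, x) \<in> R} = card {y \<in> A. (y, x) \<in> R}"
    using down_card_le[of A B x] down_card_le[of B A x] assms by simp
  then show "k = int (card {y \<in> A. (y, x) \<in> R}) - 2" using B by simp
qed (use assms in blast)

lemma face_rank_less:
  assumes "A \<in> flags R" "x \<in> A" "y \<in> A" "(x, y) \<in> R" "x \<noteq> y"
  shows "face_rank R x < face_rank R y"
proof -
  have "{z \<in> A. (z, x) \<in> R} \<subset> {z \<in> A. (z, y) \<in> R}"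
    using assms transD antisymD reflD flag_Field by blast
  then have "card {z \<in> A. (z, x) \<in> R} < card {z \<in> A. (z, y) \<in> R}"
    by (intro psubset_card_mono) (use assms flag_finite in auto)
  then show ?thesis using face_rank_eq assms by simp
qed

lemma face_rank_le_iff:
  assumes "A \<in> flags R" "x \<in> A" "y \<in> A"
  shows "(x, y) \<in> R \<longleftrightarrow> face_rank R x \<le> face_rank R y"
  using face_rank_less[of A x y] face_rank_less[of A y x] assms flag_total[of A x y] reflD flag_Field
  by (cases "x = y") auto

lemma face_rank_range:
  assumes "A \<in> flags R" "x \<in> A"
  shows "face_rank R x \<in> {-1..int n}"
proof -
  have "finite A" "card A = n + 2" using assms flag_finite flag_card by auto
  then have "card {y \<in> A. (y, x) \<in> R} \<le> n + 2"
    using card_mono[of A "{y \<in> A. (y, x) \<in> R}"] by auto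
  moreover have "card {y \<in> A. (y, x) \<in> R} > 0"
    using assms reflD flag_Field \<open>finite A\<close> by (auto simp: card_gt_0_iff)
  ultimately show ?thesis using face_rank_eq[OF assms] by auto
qed

text \<open>Rank increases strictly along a flag, and a flag has as many elements as there are ranks
  from -1 to \<open>n\<close>.\<close>

lemma face_rank_bij:
  assumes "A \<in> flags R"
  shows "bij_betw (face_rank R) A {-1..int n}"
proof -
  have "inj_on (face_rank R) A"
  proof (rule inj_onI)
    fix x y assume "x \<in> A" "y \<in> A" "face_rank R x = face_rank R y"
    then show "x = y"
      using face_rank_less[of A x y] face_rank_less[of A y x] flag_total[of A x y] assms by auto
  qed
  moreover have "face_rank R ` A = {-1..int n}"
  proof (rule card_subset_eq)
    show "card (face_rank R ` A) = card {-1..int n}"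
      using card_image[OF \<open>inj_on (face_rank R) A\<close>] flag_card[OF assms] by simp
  qed (use face_rank_range assms in auto)
  ultimately show ?thesis by (simp add: bij_betw_def)
qed

lemma flag_face:
  assumes "A \<in> flags R" "i \<in> {-1..int n}"
  shows "flag_face R A i \<in> A" "face_rank R (flag_face R A i) = i"
proof -
  note bij = face_rank_bij[OF assms(1)]
  have "i \<in> face_rank R ` A" unfolding bij_betw_imp_surj_on[OF bij] by (rule assms(2))
  then obtain x where x: "x \<in> A" "face_rank R x = i" by blast
  have "y = x" if "y \<in> A" "face_rank R y = i" for y
    using inj_onD[OF bij_betw_imp_inj_on[OF bij], of y x] that x by simp
  with x have "\<exists>!x. x \<in> A \<and> face_rank R x = i" by blast
  then have "flag_face R A i \<in> A \<and> face_rank R (flag_face R A i) = i"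
    unfolding flag_face_def by (rule theI')
  then show "flag_face R A i \<in> A" "face_rank R (flag_face R A i) = i" by auto
qed

lemma flag_face_eq:
  assumes "A \<in> flags R" "x \<in> A" "face_rank R x = i"
  shows "flag_face R A i = x"
proof -
  have "i \<in> {-1..int n}" using assms face_rank_range by blast
  from flag_face[OF assms(1) this] show ?thesis
    using inj_onD[OF bij_betw_imp_inj_on[OF face_rank_bij[OF assms(1)]], of "flag_face R A i" x] assms
    by simp
qed

lemma flag_as_faces: "A \<in> flags R \<Longrightarrow> A = flag_face R A ` {-1..int n}"
proof
  assume A: "A \<in> flags R"
  show "A \<subseteq> flag_face R A ` {-1..int n}"
    using flag_face_eq[OF A _ refl] face_rank_range[OF A] by (metis image_eqI subsetI)
  show "flag_face R A ` {-1..int n} \<subseteq> A" using flag_face[OF A] by blast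
qed

lemma flag_eqI:
  assumes "A \<in> flags R" "B \<in> flags R" "\<And>i. -1 \<le> i \<Longrightarrow> i \<le> int n \<Longrightarrow> flag_face R A i = flag_face R B i"
  shows "A = B"
proof -
  have "flag_face R A ` {-1..int n} = flag_face R B ` {-1..int n}"
    by (rule image_cong) (use assms in auto)
  then show ?thesis using flag_as_faces assms by metis
qed

text \<open>The least and the greatest face are comparable to everything, so maximality puts both
  into every flag.\<close>

lemma flag_face_extreme:
  assumes "A \<in> flags R" "B \<in> flags R"
  shows "flag_face R A (-1) = flag_face R B (-1)" "flag_face R A (int n) = flag_face R B (int n)"
proof -
  obtain l where l: "l \<in> Field R" "\<And>y. y \<in> Field R \<Longrightarrow> (l, y) \<in> R"
    using abstract by (auto simp: abstract_polytope_def)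
  obtain g where g: "g \<in> Field R" "\<And>y. y \<in> Field R \<Longrightarrow> (y, g) \<in> R"
    using abstract by (auto simp: abstract_polytope_def)
  have mem: "x \<in> A" if A: "A \<in> flags R" and x: "x \<in> Field R" "\<And>y. y \<in> Field R \<Longrightarrow> (x, y) \<in> R \<or> (y, x) \<in> R"
    for x A
  proof -
    have "insert x A \<in> Chains R"
      using flag_total[OF A] flag_Field[OF A] x by (auto simp: Chains_def)
    then have "insert x A = A" using A by (auto simp: flags_def)
    then show ?thesis by blast
  qed
  have "flag_face R A (-1) = l" if A: "A \<in> flags R" for A
  proof (rule antisymD)
    have "l \<in> A" using mem A l by blast
    then show "(flag_face R A (-1), l) \<in> R"
      using flag_face[OF A, of "-1"] face_rank_le_iff[OF A] face_rank_range[OF A, of l] by auto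
    show "(l, flag_face R A (-1)) \<in> R" using l flag_face[OF A, of "-1"] flag_Field[OF A] by auto
  qed
  then show "flag_face R A (-1) = flag_face R B (-1)" using assms by simp
  have "flag_face R A (int n) = g" if A: "A \<in> flags R" for A
  proof (rule antisymD)
    have "g \<in> A" using mem A g by blast
    then show "(g, flag_face R A (int n)) \<in> R"
      using flag_face[OF A, of "int n"] face_rank_le_iff[OF A] face_rank_range[OF A, of g] by auto
    show "(flag_face R A (int n), g) \<in> R" using g flag_face[OF A, of "int n"] flag_Field[OF A] by auto
  qed
  then show "flag_face R A (int n) = flag_face R B (int n)" using assms by simp
qed

section \<open>Adjacent flags\<close>

lemma adjacent_iff:
  "adjacent R i A B \<longleftrightarrow> A \<in> flags R \<and> B \<in> flags R \<and> A \<noteq> B \<and>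
     (\<forall>j\<in>{-1..int n}. j \<noteq> i \<longrightarrow> flag_face R A j = flag_face R B j)" (is "?L \<longleftrightarrow> ?Q")
proof
  assume L: ?L
  then have AB: "A \<in> flags R" "B \<in> flags R" by (auto simp: adjacent_def)
  have "flag_face R A j = flag_face R B j" if j: "j \<in> {-1..int n}" "j \<noteq> i" for j
  proof -
    have "flag_face R A j \<in> {x \<in> A. face_rank R x \<noteq> i}" using flag_face[OF AB(1) j(1)] j by simp
    then have "flag_face R A j \<in> B" using L by (auto simp: adjacent_def)
    then show ?thesis using flag_face_eq[OF AB(2)] flag_face[OF AB(1) j(1)] by simp
  qed
  then show ?Q using L by (auto simp: adjacent_def)
next
  assume Q: ?Q
  then have AB: "A \<in> flags R" "B \<in> flags R" by auto
  have *: "{x \<in> A. face_rank R x \<noteq> i} = flag_face R A ` ({-1..int n} - {i})" if A: "A \<in> flags R" for A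
  proof
    show "{x \<in> A. face_rank R x \<noteq> i} \<subseteq> flag_face R A ` ({-1..int n} - {i})"
    proof safe
      fix x assume x: "x \<in> A" "face_rank R x \<noteq> i"
      have "flag_face R A (face_rank R x) = x" using flag_face_eq[OF A x(1)] by simp
      then show "x \<in> flag_face R A ` ({-1..int n} - {i})"
        using face_rank_range[OF A x(1)] x(2) by (metis DiffI imageI singletonD)
    qed
    show "flag_face R A ` ({-1..int n} - {i}) \<subseteq> {x \<in> A. face_rank R x \<noteq> i}"
      using flag_face[OF A] by auto
  qed
  have "flag_face R A ` ({-1..int n} - {i}) = flag_face R B ` ({-1..int n} - {i})"
    by (rule image_cong) (use Q in auto)
  then show ?L using * Q AB unfolding adjacent_def by simp
qed

lemma adjacent_rank:
  assumes "adjacent R i A B"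
  shows "0 \<le> i" "i < int n"
proof -
  have AB: "A \<in> flags R" "B \<in> flags R" "A \<noteq> B" using assms by (auto simp: adjacent_def)
  then obtain j where j: "-1 \<le> j" "j \<le> int n" "flag_face R A j \<noteq> flag_face R B j"
    using flag_eqI by metis
  then have "j = i" using assms adjacent_iff by auto
  moreover have "j \<noteq> -1" "j \<noteq> int n" using flag_face_extreme[OF AB(1,2)] j by auto
  ultimately show "0 \<le> i" "i < int n" using j by auto
qed

lemma two_between:
  assumes "A \<in> flags R" "c < n"
  shows "card {z. z \<noteq> flag_face R A (int c - 1) \<and> z \<noteq> flag_face R A (int c + 1) \<and>
     (flag_face R A (int c - 1), z) \<in> R \<and> (z, flag_face R A (int c + 1)) \<in> R} = 2"
proof -
  have "(flag_face R A (int c - 1), flag_face R A (int c + 1)) \<in> R"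
    using face_rank_le_iff[OF assms(1)] flag_face[OF assms(1)] assms(2) by simp
  moreover have "face_rank R (flag_face R A (int c + 1)) = face_rank R (flag_face R A (int c - 1)) + 2"
    using flag_face[OF assms(1)] assms(2) by simp
  ultimately show ?thesis using abstract unfolding abstract_polytope_def by blast
qed

lemma face_between:
  assumes "A \<in> flags R" "c < n"
  shows "flag_face R A (int c) \<in> {z. z \<noteq> flag_face R A (int c - 1) \<and> z \<noteq> flag_face R A (int c + 1) \<and>
     (flag_face R A (int c - 1), z) \<in> R \<and> (z, flag_face R A (int c + 1)) \<in> R}"
proof -
  have r: "face_rank R (flag_face R A (int c - 1)) = int c - 1" "flag_face R A (int c - 1) \<in> A"
    "face_rank R (flag_face R A (int c)) = int c" "flag_face R A (int c) \<in> A"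
    "face_rank R (flag_face R A (int c + 1)) = int c + 1" "flag_face R A (int c + 1) \<in> A"
    using flag_face[OF assms(1)] assms(2) by simp_all
  then have "flag_face R A (int c) \<noteq> flag_face R A (int c - 1)"
    "flag_face R A (int c) \<noteq> flag_face R A (int c + 1)"
    by (metis add_cancel_right_right diff_add_cancel zero_neq_one)+
  then show ?thesis using face_rank_le_iff[OF assms(1)] r by simp
qed

lemma card2_other: "card S = 2 \<Longrightarrow> x \<in> S \<Longrightarrow> \<exists>y. S - {x} = {y}"
  by (metis One_nat_def Suc_1 card_1_singletonE card_Diff_singleton diff_Suc_1)

text \<open>The diamond condition supplies one other face between the faces of ranks
  \<open>c - 1\<close> and \<open>c + 1\<close>; exchanging it yields a chain of
  \<open>n + 2\<close> faces.\<close>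

lemma adjacent_exists:
  assumes A: "A \<in> flags R" and c: "c < n"
  shows "\<exists>B. adjacent R (int c) A B"
proof -
  let ?f = "flag_face R A"
  let ?S = "{z. z \<noteq> ?f (int c - 1) \<and> z \<noteq> ?f (int c + 1) \<and> (?f (int c - 1), z) \<in> R \<and> (z, ?f (int c + 1)) \<in> R}"
  obtain z where z: "?S - {?f (int c)} = {z}"
    using card2_other[OF two_between[OF assms] face_between[OF assms]] by blast
  then have z': "z \<noteq> ?f (int c - 1)" "z \<noteq> ?f (int c + 1)" "(?f (int c - 1), z) \<in> R" "(z, ?f (int c + 1)) \<in> R" "z \<noteq> ?f (int c)"
    by auto
  let ?B = "insert z (A - {?f (int c)})"
  have zF: "z \<in> Field R" using z' by (auto simp: Field_def)
  have cmp: "(x, z) \<in> R \<and> x \<noteq> z \<or> (z, x) \<in> R \<and> x \<noteq> z" if x: "x \<in> A" "x \<noteq> ?f (int c)" for x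
  proof -
    have "face_rank R x \<noteq> int c" using flag_face_eq[OF A x(1)] x by auto
    then have "face_rank R x \<le> int c - 1 \<or> face_rank R x \<ge> int c + 1" by auto
    then have "(x, ?f (int c - 1)) \<in> R \<or> (?f (int c + 1), x) \<in> R"
      using face_rank_le_iff[OF A] x flag_face[OF A] c by simp
    then show ?thesis using z' transD antisymD by blast
  qed
  have "?B \<in> Chains R" unfolding Chains_def
    using cmp flag_total[OF A] reflD[OF zF] by blast
  moreover have "card ?B = n + 2"
  proof -
    have "z \<notin> A - {?f (int c)}" using cmp by blast
    moreover have "?f (int c) \<in> A" using flag_face[OF A] c by simp
    ultimately show ?thesis using flag_finite[OF A] flag_card[OF A] by simp
  qed
  ultimately have B: "?B \<in> flags R" by (rule flagI)
  have same: "flag_face R A j = flag_face R ?B j" if j: "j \<in> {-1..int n}" "j \<noteq> int c" for j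
  proof -
    have "?f j \<noteq> ?f (int c)" using flag_face(2)[OF A j(1)] flag_face(2)[OF A, of "int c"] j c by auto
    then have "?f j \<in> ?B" using flag_face(1)[OF A j(1)] by blast
    then show ?thesis using flag_face_eq[OF B] flag_face(2)[OF A j(1)] by simp
  qed
  have "?f (int c) \<notin> ?B" using z' by blast
  moreover have "?f (int c) \<in> A" using flag_face[OF A] c by simp
  ultimately have "A \<noteq> ?B" by blast
  then show ?thesis using adjacent_iff A B same by blast
qed

text \<open>Two starting flags are allowed because the exchanged face depends only on the three
  ranks around \<open>c\<close>. Uniqueness of the adjacent flag takes the same start twice;
  commutation of distant colours needs starts that differ elsewhere.\<close>

lemma adjacent_face_unique:
  assumes "adjacent R (int c) A B" "adjacent R (int c) A' B'"
    and eq: "\<And>j. j \<in> {int c - 1, int c, int c + 1} \<Longrightarrow> flag_face R A j = flag_face R A' j"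
  shows "flag_face R B (int c) = flag_face R B' (int c)"
proof -
  have c: "c < n" using adjacent_rank[OF assms(1)] by simp
  let ?f = "flag_face R A"
  let ?S = "{z. z \<noteq> ?f (int c - 1) \<and> z \<noteq> ?f (int c + 1) \<and> (?f (int c - 1), z) \<in> R \<and> (z, ?f (int c + 1)) \<in> R}"
  have A: "A \<in> flags R" using assms by (simp add: adjacent_def)
  obtain z where z: "?S - {?f (int c)} = {z}"
    using card2_other[OF two_between[OF A c] face_between[OF A c]] by blast
  have *: "flag_face R C (int c) \<in> ?S - {?f (int c)}"
    if adj: "adjacent R (int c) D C" and eq: "\<And>j. j \<in> {int c - 1, int c, int c + 1} \<Longrightarrow> ?f j = flag_face R D j" for C D
  proof -
    have CD: "C \<in> flags R" "D \<in> flags R" "C \<noteq> D" using adj by (auto simp: adjacent_def)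
    have same: "flag_face R D j = flag_face R C j" if "j \<in> {-1..int n}" "j \<noteq> int c" for j
      using adj that adjacent_iff by blast
    have "flag_face R C (int c) \<noteq> flag_face R D (int c)"
    proof
      assume "flag_face R C (int c) = flag_face R D (int c)"
      then have "C = D" using flag_eqI[OF CD(1,2)] same by (metis atLeastAtMost_iff)
      then show False using CD by simp
    qed
    moreover have "flag_face R C (int c - 1) = ?f (int c - 1)" "flag_face R C (int c + 1) = ?f (int c + 1)"
      using same[of "int c - 1"] same[of "int c + 1"] eq c by auto
    ultimately show ?thesis using face_between[OF CD(1) c] eq by auto
  qed
  have "flag_face R B (int c) \<in> {z}" "flag_face R B' (int c) \<in> {z}"
    unfolding z[symmetric] by (rule *[OF assms(1) refl], rule *[OF assms(2) eq])
  then show ?thesis by simp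
qed

lemma adjacent_unique:
  assumes "adjacent R (int c) A B" "adjacent R (int c) A B'"
  shows "B = B'"
proof (rule flag_eqI)
  show "B \<in> flags R" "B' \<in> flags R" using assms by (auto simp: adjacent_def)
  fix j assume "-1 \<le> j" "j \<le> int n"
  then show "flag_face R B j = flag_face R B' j"
    using adjacent_face_unique[OF assms] assms adjacent_iff by (cases "j = int c") auto
qed

lemma adj_flag_eqI: "adjacent R (int c) A B \<Longrightarrow> adj_flag R (int c) A = B"
  unfolding adj_flag_def by (rule the_equality) (assumption, rule adjacent_unique)

lemma adjacent_adj_flag:
  assumes "A \<in> flags R" "c < n"
  shows "adjacent R (int c) A (adj_flag R (int c) A)"
proof -
  obtain B where "adjacent R (int c) A B" using adjacent_exists[OF assms] by blast
  then show ?thesis using adj_flag_eqI[of c A B] by simp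
qed

lemma adj_flag_closed: "A \<in> flags R \<Longrightarrow> c < n \<Longrightarrow> adj_flag R (int c) A \<in> flags R"
  using adjacent_adj_flag by (auto simp: adjacent_def)

lemma adj_flag_face:
  assumes "A \<in> flags R" "c < n" "j \<noteq> int c" "-1 \<le> j" "j \<le> int n"
  shows "flag_face R (adj_flag R (int c) A) j = flag_face R A j"
  using adjacent_adj_flag[OF assms(1,2)] adjacent_iff assms by auto

lemma adj_flag_invol:
  assumes "A \<in> flags R" "c < n"
  shows "adj_flag R (int c) (adj_flag R (int c) A) = A"
proof (rule adj_flag_eqI)
  show "adjacent R (int c) (adj_flag R (int c) A) A"
    using adjacent_adj_flag[OF assms] by (auto simp: adjacent_def)
qed

text \<open>For distant colours, exchanging the face of one rank leaves the three ranks around the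
  other untouched, so both orders bring in the same two new faces.\<close>

lemma adj_flag_comm:
  assumes "c + 1 < d" "d < n" "A \<in> flags R"
  shows "adj_flag R (int c) (adj_flag R (int d) A) = adj_flag R (int d) (adj_flag R (int c) A)"
proof (rule flag_eqI)
  have c: "c < n" using assms by simp
  note cl = adj_flag_closed[OF assms(3)] 
  note adj = adjacent_adj_flag[OF assms(3)]
  show "adj_flag R (int c) (adj_flag R (int d) A) \<in> flags R" "adj_flag R (int d) (adj_flag R (int c) A) \<in> flags R"
    using adj_flag_closed assms c by auto
  fix j assume j: "-1 \<le> j" "j \<le> int n"
  consider "j = int c" | "j = int d" | "j \<noteq> int c" "j \<noteq> int d" by blast
  then show "flag_face R (adj_flag R (int c) (adj_flag R (int d) A)) j =
      flag_face R (adj_flag R (int d) (adj_flag R (int c) A)) j"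
  proof cases
    case 1
    have "flag_face R (adj_flag R (int c) (adj_flag R (int d) A)) (int c) = flag_face R (adj_flag R (int c) A) (int c)"
      by (rule adjacent_face_unique[OF adjacent_adj_flag[OF cl[OF assms(2)] c] adj[OF c]])
        (use adj_flag_face[OF assms(3,2)] assms in auto)
    then show ?thesis using 1 adj_flag_face[OF cl[OF c] assms(2), of j] j assms by auto
  next
    case 2
    have "flag_face R (adj_flag R (int d) (adj_flag R (int c) A)) (int d) = flag_face R (adj_flag R (int d) A) (int d)"
      by (rule adjacent_face_unique[OF adjacent_adj_flag[OF cl[OF c] assms(2)] adj[OF assms(2)]])
        (use adj_flag_face[OF assms(3) c] assms in auto)
    then show ?thesis using 2 adj_flag_face[OF cl[OF assms(2)] c, of j] j assms by auto
  next
    case 3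
    then show ?thesis using adj_flag_face cl c assms j by simp
  qed
qed

section \<open>Paths of adjacent flags\<close>

lemma conn_adj_face:
  assumes "conn (\<lambda>c. adj_flag R (int c)) I A B" "A \<in> flags R" "I \<subseteq> {..<n}" "-1 \<le> j" "j \<le> int n" "j \<notin> int ` I"
  shows "flag_face R B j = flag_face R A j \<and> B \<in> flags R"
  using assms(1)
proof (induction rule: conn.induct)
  case (conn_step B c)
  then have "c < n" "j \<noteq> int c" using assms by auto
  then show ?case using conn_step adj_flag_face adj_flag_closed assms by simp
qed (use assms in simp)

text \<open>Strong flag-connectivity gives a sequence of flags that all contain
  \<open>A \<inter> B\<close>; a step with colour outside \<open>I\<close> would move a face common
  to \<open>A\<close> and \<open>B\<close>.\<close>

lemma conn_adj_of_common_faces: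
  assumes "A \<in> flags R" "B \<in> flags R" "\<And>i. i < n \<Longrightarrow> i \<notin> I \<Longrightarrow> flag_face R A (int i) = flag_face R B (int i)"
  shows "conn (\<lambda>c. adj_flag R (int c)) I A B"
proof -
  let ?R = "{(C, D). (\<exists>i. adjacent R i C D) \<and> A \<inter> B \<subseteq> C \<and> A \<inter> B \<subseteq> D}"
  have "(A, B) \<in> ?R\<^sup>*"
    using abstract assms by (auto simp: abstract_polytope_def strongly_flag_connected_def)
  then show ?thesis
  proof (induction rule: rtrancl_induct)
    case base
    show ?case by (rule conn_refl)
  next
    case (step C D)
    then obtain i where i: "adjacent R i C D" "A \<inter> B \<subseteq> C" "A \<inter> B \<subseteq> D" by auto
    define c where "c = nat i"
    have c: "i = int c" "c < n" using adjacent_rank[OF i(1)] by (auto simp: c_def)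
    have CD: "C \<in> flags R" "D \<in> flags R" "C \<noteq> D" using i by (auto simp: adjacent_def)
    have D: "D = adj_flag R (int c) C" using adj_flag_eqI i c by simp
    have "c \<in> I"
    proof (rule ccontr)
      assume "c \<notin> I"
      define x where "x = flag_face R A (int c)"
      have x: "x \<in> A" "x \<in> B" "face_rank R x = int c"
        using flag_face[OF assms(1), of "int c"] flag_face[OF assms(2), of "int c"] assms(3)[OF c(2) \<open>c \<notin> I\<close>] c
        by (auto simp: x_def)
      then have "flag_face R C (int c) = x" "flag_face R D (int c) = x"
        using flag_face_eq CD i by auto
      moreover have "flag_face R C j = flag_face R D j" if "j \<in> {-1..int n}" "j \<noteq> int c" for j
        using i(1) adjacent_iff c that by blast
      ultimately have "C = D" using flag_eqI[OF CD(1,2)] by (metis atLeastAtMost_iff)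
      then show False using CD by simp
    qed
    then show ?case unfolding D by (rule conn_step[OF step.IH])
  qed
qed

lemma polytopal_maniplex_flags: "polytopal_maniplex n (flags R) (\<lambda>c. adj_flag R (int c))"
proof (unfold_locales, goal_cases)
  case (3 c d A)
  then show ?case by (rule adj_flag_comm)
next
  case (4 A B)
  then show ?case by (intro conn_adj_of_common_faces) auto
next
  case (5 c A)
  then show ?case using adjacent_adj_flag by (auto simp: adjacent_def)
next
  case (6 i j A B)
  have I: "{i<..<n} \<subseteq> {..<n}" "{..<j} \<subseteq> {..<n}" using 6 by auto
  \<comment> \<open>Rank -1 serves here only to extract from \<open>conn_adj_face\<close> that
    \<open>B\<close> is a flag.\<close>
  have "(-1::int) \<notin> int ` {i<..<n}" by auto
  then have "B \<in> flags R" using conn_adj_face[OF 6(4,3) I(1), of "-1"] by simp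
  then show ?case
  proof (intro conn_adj_of_common_faces)
    \<comment> \<open>Colours above \<open>i\<close> keep the faces up to rank \<open>i\<close>,
      colours below \<open>j\<close> keep those from rank \<open>j\<close> on.\<close>
    fix k assume k: "k < n" "k \<notin> {i<..<j}"
    then show "flag_face R A (int k) = flag_face R B (int k)"
    proof (cases "k \<le> i")
      case True
      then show ?thesis using conn_adj_face[OF 6(4,3) I(1), of "int k"] k(1) by (auto simp: inj_image_mem_iff)
    next
      case False
      then show ?thesis using conn_adj_face[OF 6(5,3) I(2), of "int k"] k by (auto simp: inj_image_mem_iff)
    qed
  qed (use 6 in auto)
qed (use adj_flag_closed adj_flag_invol in auto)

end

section \<open>Groups acting on flags by rotations\<close>

text \<open>Elements of \<open>G\<close> need not be maps, so that groups of pairs fit as well.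
  \<open>act_r\<close> lets them commute with all colours, while \<open>act_s\<close> relates a
  rotation to colour steps at \<open>x0\<close> only.\<close>

locale rotary = flag_system n F r + group G
  for n and F :: "'x set" and r and G :: "('g, 'm) monoid_scheme" (structure) +
  fixes act :: "'g \<Rightarrow> 'x \<Rightarrow> 'x" and s :: "nat \<Rightarrow> 'g" and x0 :: 'x
  assumes two_le: "2 \<le> n"
    and act_closed: "g \<in> carrier G \<Longrightarrow> x \<in> F \<Longrightarrow> act g x \<in> F"
    and act_mult: "g \<in> carrier G \<Longrightarrow> h \<in> carrier G \<Longrightarrow> x \<in> F \<Longrightarrow> act (g \<otimes> h) x = act g (act h x)"
    and act_one: "x \<in> F \<Longrightarrow> act \<one> x = x"
    and act_r: "g \<in> carrier G \<Longrightarrow> x \<in> F \<Longrightarrow> c < n \<Longrightarrow> act g (r c x) = r c (act g x)"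
    and x0: "x0 \<in> F"
    and s_closed: "1 \<le> i \<Longrightarrow> i < n \<Longrightarrow> s i \<in> carrier G"
    and act_s: "1 \<le> i \<Longrightarrow> i < n \<Longrightarrow> act (s i) x0 = r i (r (i - 1) x0)"
    and generated: "carrier G = generate G (s ` {1..n - 1})"
    and connected_x0: "x \<in> F \<Longrightarrow> conn r {..<n} x0 x"
    and act_free: "g \<in> carrier G \<Longrightarrow> act g x0 = x0 \<Longrightarrow> g = \<one>"
begin

lemma act_inv: "g \<in> carrier G \<Longrightarrow> x \<in> F \<Longrightarrow> act (inv g) (act g x) = x"
  using act_mult[of "inv g" g x] act_one by simp

lemma act_inv': "g \<in> carrier G \<Longrightarrow> x \<in> F \<Longrightarrow> act g (act (inv g) x) = x"
  using act_mult[of g "inv g" x] act_one by simp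

lemma act_inj:
  assumes "g \<in> carrier G" "h \<in> carrier G" "act g x0 = act h x0"
  shows "g = h"
proof -
  have "act (inv h \<otimes> g) x0 = x0" using act_mult act_inv assms x0 by simp
  then have "inv h \<otimes> g = \<one>" using act_free assms by simp
  then show ?thesis using assms by (metis inv_equality inv_inv inv_closed)
qed

lemma act_conn:
  assumes "conn r I x y" "I \<subseteq> {..<n}" "x \<in> F" "g \<in> carrier G"
  shows "conn r I (act g x) (act g y)"
  using assms(1)
proof (induction rule: conn.induct)
  case conn_refl
  show ?case by (rule conn.conn_refl)
next
  case (conn_step y c)
  have "y \<in> F" "c < n" using conn_closed[OF conn_step(1)] conn_step(2) assms by auto
  then show ?case using conn.conn_step[OF conn_step.IH conn_step(2)] act_r assms by simp
qed

text \<open>The product telescopes: \<open>s k\<close> commutes with colours, so it takes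
  \<open>r j (r k x0)\<close> to \<open>r j (r k (r k (r (k - 1) x0)))\<close>, where
  \<open>r k\<close> cancels. The induction runs downwards because \<open>foldr\<close> adds factors
  on the left.\<close>

lemma act_tau:
  assumes "1 \<le> i" "i \<le> j" "j < n"
  shows "\<tau> G n s i j \<in> carrier G" "act (\<tau> G n s i j) x0 = r j (r (i - 1) x0)"
proof -
  have "1 \<le> i \<longrightarrow> foldr (\<lambda>k x. s k \<otimes> x) [i..<Suc j] \<one> \<in> carrier G \<and>
      act (foldr (\<lambda>k x. s k \<otimes> x) [i..<Suc j] \<one>) x0 = r j (r (i - 1) x0)"
    using \<open>i \<le> j\<close>
  proof (induction rule: inc_induct)
    case base
    then show ?case using s_closed act_s assms by simp
  next
    case (step k)
    let ?t = "foldr (\<lambda>k x. s k \<otimes> x) [Suc k..<Suc j] \<one>"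
    show ?case
    proof
      assume k: "1 \<le> k"
      have t: "?t \<in> carrier G" "act ?t x0 = r j (r k x0)" using step by simp_all
      have sk: "s k \<in> carrier G" "act (s k) x0 = r k (r (k - 1) x0)"
        using s_closed act_s k step assms by simp_all
      have F: "r k x0 \<in> F" "r (k - 1) x0 \<in> F" using r_closed x0 step assms by auto
      have "act (s k \<otimes> ?t) x0 = act (s k) (r j (r k x0))" using act_mult sk t x0 by simp
      also have "\<dots> = r j (r k (act (s k) x0))" using act_r sk(1) F x0 step assms by simp
      also have "\<dots> = r j (r (k - 1) x0)" using sk(2) r_invol F step assms by simp
      finally have "act (s k \<otimes> ?t) x0 = r j (r (k - 1) x0)" .
      moreover have "[k..<Suc j] = k # [Suc k..<Suc j]" using step by (simp add: upt_conv_Cons)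
      ultimately show "foldr (\<lambda>k x. s k \<otimes> x) [k..<Suc j] \<one> \<in> carrier G \<and>
        act (foldr (\<lambda>k x. s k \<otimes> x) [k..<Suc j] \<one>) x0 = r j (r (k - 1) x0)"
        using sk t by simp
    qed
  qed
  then show "\<tau> G n s i j \<in> carrier G" "act (\<tau> G n s i j) x0 = r j (r (i - 1) x0)"
    using assms by (auto simp: \<tau>_def simp del: upt_Suc)
qed

text \<open>The ranks -1 and \<open>n\<close> in an index set contribute only trivial generators to
  \<open>\<Gamma>\<close>, so the colours among the indices are what matters.\<close>

definition colours :: "int set \<Rightarrow> nat set" where
  "colours I = {c. c < n \<and> int c \<in> I}"

lemma colours_subset: "colours I \<subseteq> {..<n}"
  by (auto simp: colours_def)

lemma Gamma_generators: "{\<tau> G n s i j |i j. i \<le> j \<and> j \<le> n \<and> int i - 1 \<in> I \<and> int j \<in> I} \<subseteq> carrier G"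
proof safe
  fix i j assume "i \<le> j" "j \<le> n"
  then show "\<tau> G n s i j \<in> carrier G"
    using act_tau(1)[of i j] by (cases "i = 0 \<or> j = n") (auto simp: \<tau>_def)
qed

lemma Gamma_subgroup: "subgroup (\<Gamma> G n s I) G"
  unfolding \<Gamma>_def by (rule generate_is_subgroup[OF Gamma_generators])

lemma Gamma_closed: "g \<in> \<Gamma> G n s I \<Longrightarrow> g \<in> carrier G"
  using subgroup.mem_carrier[OF Gamma_subgroup] .

text \<open>For \<open>c < d\<close> the element is the generator \<open>\<tau>\<close> with indices
  \<open>c + 1\<close> and \<open>d\<close>, for \<open>d < c\<close> the inverse of such a
  generator.\<close>

lemma two_steps:
  assumes "c \<in> colours I" "d \<in> colours I"
  shows "\<exists>h\<in>\<Gamma> G n s I. act h x0 = r d (r c x0)"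
proof -
  have cd: "c < n" "d < n" "int c \<in> I" "int d \<in> I" using assms by (auto simp: colours_def)
  have gen: "\<tau> G n s (Suc a) b \<in> \<Gamma> G n s I" if "a < b" "b < n" "int a \<in> I" "int b \<in> I" for a b
    unfolding \<Gamma>_def by (rule generate.incl) (use that in force)
  consider "c < d" | "c = d" | "d < c" by linarith
  then show ?thesis
  proof cases
    case 1
    then show ?thesis using gen[OF 1] act_tau(2)[of "Suc c" d] cd by auto
  next
    case 2
    then show ?thesis using subgroup.one_closed[OF Gamma_subgroup] act_one r_invol x0 cd by auto
  next
    case 3
    let ?t = "\<tau> G n s (Suc d) c"
    have t: "?t \<in> \<Gamma> G n s I" "?t \<in> carrier G" "act ?t x0 = r c (r d x0)"
      using gen[OF 3] act_tau[of "Suc d" c] 3 cd by auto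
    have "act ?t (r d (r c x0)) = r d (r c (r c (r d x0)))"
      using act_r t r_closed x0 cd by simp
    also have "\<dots> = x0" using r_invol r_closed x0 cd by simp
    finally have "act (inv ?t) x0 = r d (r c x0)"
      using act_inv[OF t(2), of "r d (r c x0)"] r_closed x0 cd by simp
    then show ?thesis using subgroup.m_inv_closed[OF Gamma_subgroup t(1)] by blast
  qed
qed

text \<open>A generator takes \<open>x0\<close> two colour steps away or fixes it. Since the action
  commutes with colours, such paths can be transported and concatenated.\<close>

lemma Gamma_conn:
  assumes "g \<in> \<Gamma> G n s I"
  shows "conn r (colours I) x0 (act g x0)"
proof -
  have conn_inv: "conn r (colours I) x0 (act (inv g) x0)" if "g \<in> carrier G" "conn r (colours I) x0 (act g x0)" for g
  proof -
    have "conn r (colours I) (act (inv g) x0) (act (inv g) (act g x0))"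
      using act_conn[OF that(2) colours_subset x0] that by simp
    then have "conn r (colours I) (act (inv g) x0) x0" using act_inv x0 that by simp
    then show ?thesis by (rule conn_sym[OF _ colours_subset]) (use act_closed x0 that in simp)
  qed
  have gen: "conn r (colours I) x0 (act h x0)"
    if hh: "h \<in> {\<tau> G n s i j |i j. i \<le> j \<and> j \<le> n \<and> int i - 1 \<in> I \<and> int j \<in> I}" for h
  proof -
    obtain i j where ij: "h = \<tau> G n s i j" "i \<le> j" "j \<le> n" "int i - 1 \<in> I" "int j \<in> I"
      using hh by blast
    show ?thesis
    proof (cases "i = 0 \<or> j = n")
      case True
      then have "act h x0 = x0" using ij act_one x0 by (simp add: \<tau>_def)
      then show ?thesis using conn_refl[of r _ x0] by simp
    next
      case False
      then have "i - 1 \<in> colours I" "j \<in> colours I" using ij by (auto simp: colours_def of_nat_diff)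
      then have "conn r (colours I) x0 (r j (r (i - 1) x0))" by (intro conn_step conn_refl)
      then show ?thesis using act_tau(2)[of i j] ij False by simp
    qed
  qed
  have "g \<in> carrier G \<and> conn r (colours I) x0 (act g x0)"
    using assms unfolding \<Gamma>_def
  proof (induction rule: generate.induct)
    case one
    then show ?case using act_one x0 conn_refl[of r _ x0] by simp
  next
    case (incl h)
    then show ?case using gen Gamma_generators by blast
  next
    case (inv h)
    then have "h \<in> carrier G" using Gamma_generators by blast
    then show ?case using conn_inv[OF _ gen[OF inv]] by simp
  next
    case (eng g h)
    then have "conn r (colours I) (act g x0) (act g (act h x0))"
      using act_conn[OF _ colours_subset x0] by simp
    then show ?case using eng act_mult x0 conn_trans[of r "colours I" "act g x0"] by simp
  qed
  then show ?thesis by simp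
qed

text \<open>The steps of a path are taken in pairs, each realised by \<open>two_steps\<close>. A
  path of odd length leaves one reflection over, whose colour stays in \<open>I\<close>.\<close>

lemma conn_cover:
  assumes "conn r (colours I) x0 y"
  shows "\<exists>h\<in>\<Gamma> G n s I. y = act h x0 \<or> (\<exists>c\<in>colours I. y = act h (r c x0))"
  using assms
proof (induction rule: conn.induct)
  case conn_refl
  then show ?case using subgroup.one_closed[OF Gamma_subgroup] act_one x0 by metis
next
  case (conn_step y d)
  then obtain h where h: "h \<in> \<Gamma> G n s I" "y = act h x0 \<or> (\<exists>c\<in>colours I. y = act h (r c x0))" by blast
  have d: "d < n" using conn_step(2) by (simp add: colours_def)
  have hG: "h \<in> carrier G" using h Gamma_closed by blast
  show ?case using h(2)
  proof
    assume "y = act h x0"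
    then have "r d y = act h (r d x0)" using act_r hG x0 d by simp
    then show ?thesis using h(1) conn_step(2) by blast
  next
    assume "\<exists>c\<in>colours I. y = act h (r c x0)"
    then obtain c where c: "c \<in> colours I" "y = act h (r c x0)" by blast
    then have "c < n" by (simp add: colours_def)
    obtain t where t: "t \<in> \<Gamma> G n s I" "act t x0 = r d (r c x0)" using two_steps c conn_step(2) by blast
    have "r d y = act h (r d (r c x0))" using act_r hG r_closed x0 d c \<open>c < n\<close> by simp
    also have "\<dots> = act (h \<otimes> t) x0" using act_mult hG Gamma_closed t x0 by simp
    finally show ?thesis using subgroup.m_closed[OF Gamma_subgroup h(1) t(1)] by blast
  qed
qed

lemma pair_element:
  assumes "c < n" "d < n"
  shows "\<exists>h\<in>carrier G. act h x0 = r d (r c x0)"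
  using two_steps[of c UNIV d] Gamma_closed assms by (auto simp: colours_def)

lemma change_colour:
  assumes "c < n" "d < n"
  shows "\<exists>h\<in>carrier G. r c x0 = act h (r d x0)"
proof -
  obtain h where h: "h \<in> carrier G" "act h x0 = r d (r c x0)" using pair_element assms by blast
  then have "act h (r d x0) = r c x0" using act_r r_invol r_closed x0 assms by simp
  then show ?thesis using h by metis
qed

text \<open>There are at most two orbits: a leftover reflection is converted to the prescribed
  colour \<open>d\<close> by \<open>change_colour\<close>.\<close>

lemma cover:
  assumes "x \<in> F" "d < n"
  shows "\<exists>h\<in>carrier G. x = act h x0 \<or> x = act h (r d x0)"
proof -
  have U: "colours UNIV = {..<n}" by (auto simp: colours_def)
  then have "conn r (colours UNIV) x0 x" using connected_x0 assms by simp
  from conn_cover[OF this] obtain h where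
    "h \<in> \<Gamma> G n s UNIV" "x = act h x0 \<or> (\<exists>c\<in>{..<n}. x = act h (r c x0))" unfolding U by blast
  then have h: "h \<in> carrier G" "x = act h x0 \<or> (\<exists>c<n. x = act h (r c x0))"
    using Gamma_closed by auto
  show ?thesis using h(2)
  proof
    assume "\<exists>c<n. x = act h (r c x0)"
    then obtain c where c: "c < n" "x = act h (r c x0)" by blast
    obtain k where k: "k \<in> carrier G" "r c x0 = act k (r d x0)" using change_colour c assms by blast
    then have "x = act (h \<otimes> k) (r d x0)" using c h act_mult r_closed x0 assms by simp
    then show ?thesis using h k by blast
  qed (use h in blast)
qed

text \<open>Membership in the orbit of \<open>x0\<close> serves as parity. If the orbit omits
  \<open>r 0 x0\<close>, it omits all neighbours of its members, because the neighbours of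
  \<open>x0\<close> for different colours are equivalent under \<open>G\<close>.\<close>

lemma orientation_exists:
  assumes no: "\<And>h. h \<in> carrier G \<Longrightarrow> act h x0 \<noteq> r 0 x0" and x: "x \<in> F" and c: "c < n"
  shows "(\<exists>h\<in>carrier G. r c x = act h x0) \<longleftrightarrow> \<not> (\<exists>h\<in>carrier G. x = act h x0)"
proof
  assume "\<not> (\<exists>h\<in>carrier G. x = act h x0)"
  then obtain h where h: "h \<in> carrier G" "x = act h (r c x0)" using cover[OF x c] by blast
  then have "r c x = act h x0" using act_r r_invol act_closed x0 c by simp
  then show "\<exists>h\<in>carrier G. r c x = act h x0" using h by blast
next
  assume "\<exists>h\<in>carrier G. r c x = act h x0"
  then obtain h where h: "h \<in> carrier G" "r c x = act h x0" by blast
  show "\<not> (\<exists>h\<in>carrier G. x = act h x0)"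
  proof
    assume "\<exists>h\<in>carrier G. x = act h x0"
    then obtain k where k: "k \<in> carrier G" "x = act k x0" by blast
    have n: "0 < n" using two_le by simp
    have "act k (r c x0) = act h x0" using h k act_r x0 c by simp
    then have "r c x0 = act (inv k \<otimes> h) x0"
      using act_mult h k x0 act_inv[OF k(1), of "r c x0"] r_closed c by simp
    moreover obtain t where t: "t \<in> carrier G" "r 0 x0 = act t (r c x0)" using change_colour c n by blast
    ultimately have "r 0 x0 = act (t \<otimes> (inv k \<otimes> h)) x0" using act_mult h k x0 by simp
    then show False using no[of "t \<otimes> (inv k \<otimes> h)"] t h k by simp
  qed
qed

text \<open>\<open>act_s\<close> describes \<open>s i\<close> at \<open>x0\<close> alone, but the
  mix needs a power of the two colour steps that fixes any given flag. The map \<open>w\<close>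
  commutes with \<open>G\<close>, so \<open>x0\<close> and \<open>r i x0\<close> suffice; passing to
  \<open>r i x0\<close> turns \<open>w\<close> into its inverse \<open>v\<close>.\<close>

lemma rotation_period:
  assumes i: "1 \<le> i" "i < n" and x: "x \<in> F"
  shows "((\<lambda>x. r i (r (i - 1) x)) ^^ ord (s i)) x = x"
proof -
  define w where "w x = r i (r (i - 1) x)" for x
  define v where "v x = r (i - 1) (r i x)" for x
  have i': "i - 1 < n" using i by simp
  have wF: "(w ^^ k) y \<in> F" if "y \<in> F" for k y
    by (induction k) (use that r_closed i i' in \<open>auto simp: w_def\<close>)
  have vF: "(v ^^ k) y \<in> F" if "y \<in> F" for k y
    by (induction k) (use that r_closed i i' in \<open>auto simp: v_def\<close>)
  have wact: "(w ^^ k) (act g y) = act g ((w ^^ k) y)" if "y \<in> F" "g \<in> carrier G" for k y g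
  proof (induction k)
    case (Suc k)
    have "w (act g z) = act g (w z)" if "z \<in> F" for z
      using that \<open>g \<in> carrier G\<close> r_closed i i' act_r by (simp add: w_def)
    then show ?case using Suc wF[OF \<open>y \<in> F\<close>, of k] by simp
  qed simp
  have ws: "(w ^^ k) x0 = act (s i [^] k) x0" for k
  proof (induction k)
    case 0
    then show ?case using act_one x0 by simp
  next
    case (Suc k)
    have "(w ^^ Suc k) x0 = w (act (s i [^] k) x0)" using Suc by simp
    also have "\<dots> = act (s i [^] k) (w x0)"
      using wact[of x0 "s i [^] k" 1] s_closed i x0 by simp
    also have "\<dots> = act (s i [^] Suc k) x0"
      using act_s[OF i] s_closed[OF i] act_mult x0 by (simp add: w_def)
    finally show ?case .
  qed
  define p where "p = ord (s i)"
  have p0: "(w ^^ p) x0 = x0" using ws[of p] pow_ord_eq_1[OF s_closed[OF i]] act_one x0 by (simp add: p_def)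
  have wv: "(v ^^ k) ((w ^^ k) y) = y" if "y \<in> F" for k y
  proof (induction k)
    case (Suc k)
    have "(v ^^ Suc k) ((w ^^ Suc k) y) = (v ^^ k) (v (w ((w ^^ k) y)))"
      by (simp add: funpow_swap1)
    also have "v (w ((w ^^ k) y)) = (w ^^ k) y"
      using wF[OF that] r_closed r_invol i i' by (simp add: v_def w_def)
    finally show ?case using Suc by simp
  qed simp
  have wr: "(w ^^ k) (r i y) = r i ((v ^^ k) y)" if "y \<in> F" for k y
    by (induction k) (use that vF[OF that] in \<open>simp_all add: w_def v_def\<close>)
  have p1: "(w ^^ p) (r i x0) = r i x0" using wr[OF x0, of p] wv[OF x0, of p] p0 by simp
  obtain h where "h \<in> carrier G" "x = act h x0 \<or> x = act h (r i x0)" using cover[OF x i(2)] by blast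
  then have "(w ^^ p) x = x" using wact p0 p1 x0 r_closed i by auto
  moreover have "w = (\<lambda>x. r i (r (i - 1) x))" by (rule ext) (simp add: w_def)
  ultimately show ?thesis by (simp add: p_def)
qed

end

text \<open>Parity is any predicate that alternates along colours, so that the mix can take it over
  from its first component.\<close>

locale oriented_rotary = rotary +
  fixes even_flag :: "'a \<Rightarrow> bool"
  assumes even_flag_r: "c < n \<Longrightarrow> x \<in> F \<Longrightarrow> even_flag (r c x) \<longleftrightarrow> \<not> even_flag x"
begin

text \<open>As \<open>g\<close> commutes with colours, whether it preserves parity has the same
  answer at adjacent flags; a single flag then decides.\<close>

lemma even_flag_conn:
  assumes "conn r I x y" "I \<subseteq> {..<n}" "x \<in> F" "g \<in> carrier G"
  shows "(even_flag (act g y) = even_flag y) = (even_flag (act g x) = even_flag x)"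
  using assms(1)
proof (induction rule: conn.induct)
  case (conn_step y c)
  have "y \<in> F" "c < n" using conn_closed[OF conn_step(1)] conn_step(2) assms by auto
  then show ?case using conn_step.IH act_r even_flag_r act_closed assms by simp
qed simp

lemma even_flag_act:
  assumes "g \<in> carrier G" "x \<in> F"
  shows "even_flag (act g x) = even_flag x"
proof -
  have s: "s i \<in> carrier G \<and> (\<forall>x\<in>F. even_flag (act (s i) x) = even_flag x)" if "i \<in> {1..n-1}" for i
  proof -
    have i: "1 \<le> i" "i < n" "i - 1 < n" using that two_le by auto
    then have "even_flag (act (s i) x0) = even_flag x0"
      using act_s even_flag_r r_closed x0 by simp
    then show ?thesis using even_flag_conn[OF connected_x0, of _ "s i"] s_closed[OF i(1,2)] x0 by blast
  qed
  have "g \<in> generate G (s ` {1..n-1})" using assms generated by simp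
  then have "g \<in> carrier G \<and> (\<forall>x\<in>F. even_flag (act g x) = even_flag x)"
  proof (induction rule: generate.induct)
    case one
    then show ?case using act_one by simp
  next
    case (incl h)
    then show ?case using s by blast
  next
    case (inv h)
    then have h: "h \<in> carrier G" "\<forall>x\<in>F. even_flag (act h x) = even_flag x" using s by blast+
    have "even_flag (act (inv h) x) = even_flag x" if "x \<in> F" for x
      using h(2)[rule_format, of "act (inv h) x"] act_inv' act_closed h(1) that by simp
    then show ?case using h by simp
  next
    case (eng g h)
    then show ?case using act_mult act_closed by simp
  qed
  then show ?thesis using assms by blast
qed

lemma even_orbit: "(\<exists>h\<in>carrier G. x = act h x0) \<longleftrightarrow> even_flag x = even_flag x0" if x: "x \<in> F"
proof -
  have n: "0 < n" using two_le by simp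
  obtain h where h: "h \<in> carrier G" "x = act h x0 \<or> x = act h (r 0 x0)" using cover[OF x n] by blast
  moreover have "even_flag (act h (r 0 x0)) \<noteq> even_flag x0"
    using even_flag_act h r_closed x0 n even_flag_r by simp
  ultimately show ?thesis using even_flag_act x0 by blast
qed

text \<open>Parity excludes the leftover reflection in \<open>conn_cover\<close>, and freeness at
  \<open>x0\<close> identifies the group element. Membership in \<open>\<Gamma>\<close> thereby
  becomes a question about paths.\<close>

lemma Gamma_iff:
  assumes "g \<in> carrier G"
  shows "g \<in> \<Gamma> G n s I \<longleftrightarrow> conn r (colours I) x0 (act g x0)"
proof
  assume "conn r (colours I) x0 (act g x0)"
  from conn_cover[OF this] obtain h where
    h: "h \<in> \<Gamma> G n s I" "act g x0 = act h x0 \<or> (\<exists>c\<in>colours I. act g x0 = act h (r c x0))" by blast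
  have hG: "h \<in> carrier G" using h Gamma_closed by blast
  have "act g x0 \<noteq> act h (r c x0)" if "c \<in> colours I" for c
  proof -
    have "c < n" using that by (simp add: colours_def)
    then have "even_flag (act h (r c x0)) \<noteq> even_flag x0"
      using even_flag_act hG r_closed x0 even_flag_r by simp
    then show ?thesis using even_flag_act[OF assms x0] by metis
  qed
  then have "g = h" using h(2) act_inj assms hG by blast
  then show "g \<in> \<Gamma> G n s I" using h by simp
qed (rule Gamma_conn)

end

section \<open>Automorphisms of an abstract polytope\<close>

context polytope
begin

abbreviation "Aut \<equiv> aut_group R"
abbreviation "adj c \<equiv> adj_flag R (int c)"

lemma aut_carrier: "f \<in> carrier Aut \<longleftrightarrow> f \<in> Bij (Field R) \<and>
    (\<forall>x\<in>Field R. \<forall>y\<in>Field R. (f x, f y) \<in> R \<longleftrightarrow> (x, y) \<in> R)"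
  by (simp add: aut_group_def)

lemma aut_mult: "f \<in> carrier Aut \<Longrightarrow> g \<in> carrier Aut \<Longrightarrow> f \<otimes>\<^bsub>Aut\<^esub> g = compose (Field R) f g"
  by (simp add: aut_group_def BijGroup_def)

lemma aut_one: "\<one>\<^bsub>Aut\<^esub> = (\<lambda>x\<in>Field R. x)"
  by (simp add: aut_group_def BijGroup_def)

lemma group_aut: "group Aut"
proof -
  let ?B = "BijGroup (Field R)"
  let ?H = "{f \<in> Bij (Field R). \<forall>x \<in> Field R. \<forall>y \<in> Field R. (f x, f y) \<in> R \<longleftrightarrow> (x, y) \<in> R}"
  interpret B: group ?B by (rule group_BijGroup)
  have "subgroup ?H ?B"
  proof (rule B.subgroupI)
    show "?H \<subseteq> carrier ?B" by (auto simp: BijGroup_def)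
    have "(\<lambda>x\<in>Field R. x) \<in> ?H" by (simp add: id_Bij)
    then show "?H \<noteq> {}" by blast
  next
    fix f assume f: "f \<in> ?H"
    then have fB: "f \<in> Bij (Field R)" by simp
    then have bij: "bij_betw f (Field R) (Field R)" by (simp add: Bij_def)
    have "(inv_into (Field R) f x, inv_into (Field R) f y) \<in> R \<longleftrightarrow> (x, y) \<in> R"
      if xy: "x \<in> Field R" "y \<in> Field R" for x y
    proof -
      have "inv_into (Field R) f x \<in> Field R" "inv_into (Field R) f y \<in> Field R"
        using Bij_inv_into_mem[OF fB] xy by auto
      moreover have "f (inv_into (Field R) f x) = x" "f (inv_into (Field R) f y) = y"
        using bij_betw_inv_into_right[OF bij] xy by auto
      moreover have "(f a, f b) \<in> R \<longleftrightarrow> (a, b) \<in> R" if "a \<in> Field R" "b \<in> Field R" for a b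
        using f that by simp
      ultimately show ?thesis by metis
    qed
    then show "inv\<^bsub>?B\<^esub> f \<in> ?H"
      using restrict_inv_into_Bij[OF fB] by (simp add: inv_BijGroup[OF fB])
  next
    fix f g assume fg: "f \<in> ?H" "g \<in> ?H"
    then have "g x \<in> Field R" if "x \<in> Field R" for x
      using Bij_imp_funcset[of g "Field R"] that by auto
    then show "f \<otimes>\<^bsub>?B\<^esub> g \<in> ?H"
      using fg by (simp add: BijGroup_def compose_Bij) (simp add: compose_def)
  qed
  then show ?thesis unfolding aut_group_def by (rule subgroup.subgroup_is_group) (rule group_BijGroup)
qed

lemma aut_inj: "f \<in> carrier Aut \<Longrightarrow> inj_on f (Field R)"
  by (simp add: aut_carrier Bij_def bij_betw_def)

lemma aut_rel: "f \<in> carrier Aut \<Longrightarrow> x \<in> Field R \<Longrightarrow> y \<in> Field R \<Longrightarrow> (f x, f y) \<in> R \<longleftrightarrow> (x, y) \<in> R"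
  by (simp add: aut_carrier)

lemma aut_mult_image:
  "f \<in> carrier Aut \<Longrightarrow> g \<in> carrier Aut \<Longrightarrow> A \<in> flags R \<Longrightarrow> (f \<otimes>\<^bsub>Aut\<^esub> g) ` A = f ` g ` A"
  using flag_Field[of A] by (auto simp: aut_mult compose_def image_iff)

lemma aut_one_image: "A \<in> flags R \<Longrightarrow> \<one>\<^bsub>Aut\<^esub> ` A = A"
  using flag_Field[of A] by (auto simp: aut_one image_iff)

lemma aut_flag:
  assumes "f \<in> carrier Aut" "A \<in> flags R"
  shows "f ` A \<in> flags R"
proof (rule flagI)
  have AF: "A \<subseteq> Field R" using assms flag_Field by blast
  then show "f ` A \<in> Chains R"
    using flag_total[OF assms(2)] aut_rel[OF assms(1)] by (auto simp: Chains_def) (meson subsetD)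
  show "card (f ` A) = n + 2"
    using card_image[OF inj_on_subset[OF aut_inj[OF assms(1)] AF]] flag_card[OF assms(2)] by simp
qed

lemma aut_face_rank:
  assumes "f \<in> carrier Aut" "A \<in> flags R" "x \<in> A"
  shows "face_rank R (f x) = face_rank R x"
proof -
  have AF: "A \<subseteq> Field R" using assms flag_Field by blast
  have "{y \<in> f ` A. (y, f x) \<in> R} = f ` {y \<in> A. (y, x) \<in> R}"
    using aut_rel[OF assms(1)] AF assms(3) by blast
  moreover have "inj_on f {y \<in> A. (y, x) \<in> R}"
    by (rule inj_on_subset[OF aut_inj[OF assms(1)]]) (use AF in auto)
  ultimately show ?thesis
    using face_rank_eq[OF assms(2,3)] face_rank_eq[OF aut_flag[OF assms(1,2)], of "f x"] assms(3)
    by (simp add: card_image)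
qed

lemma aut_flag_face:
  assumes "f \<in> carrier Aut" "A \<in> flags R" "-1 \<le> i" "i \<le> int n"
  shows "flag_face R (f ` A) i = f (flag_face R A i)"
  using flag_face_eq[OF aut_flag[OF assms(1,2)], of "f (flag_face R A i)" i] flag_face[OF assms(2), of i]
    aut_face_rank[OF assms(1,2), of "flag_face R A i"] assms by auto

lemma aut_adj:
  assumes f: "f \<in> carrier Aut" and A: "A \<in> flags R" and c: "c < n"
  shows "f ` adj c A = adj c (f ` A)"
proof -
  have B: "adj c A \<in> flags R" "adj c A \<noteq> A"
    using adjacent_adj_flag[OF A c] by (auto simp: adjacent_def)
  have "f ` A \<noteq> f ` adj c A"
    using inj_on_image_eq_iff[OF aut_inj[OF f]] flag_Field A B by metis
  then have "adjacent R (int c) (f ` A) (f ` adj c A)"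
    unfolding adjacent_iff using aut_flag[OF f] A B aut_flag_face[OF f] adj_flag_face[OF A c] by auto
  then show ?thesis using adj_flag_eqI by metis
qed

lemma in_flag: "x \<in> Field R \<Longrightarrow> \<exists>A\<in>flags R. x \<in> A"
  using flag_extension[of "{x}"] reflD by (auto simp: Chains_def)

text \<open>Automorphisms commute with adjacency, so fixing one flag means fixing all, and a face is
  the only one of its rank in a flag. Extensionality settles the values outside the set of
  faces.\<close>

lemma aut_free:
  assumes f: "f \<in> carrier Aut" and A: "A \<in> flags R" "f ` A = A"
  shows "f = \<one>\<^bsub>Aut\<^esub>"
proof -
  have fixes_flags: "f ` B = B" if B: "B \<in> flags R" for B
  proof -
    have "conn adj {..<n} A B" by (rule conn_adj_of_common_faces) (use A B in auto)
    then have "f ` B = B \<and> B \<in> flags R"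
      by (induction rule: conn.induct) (use A aut_adj[OF f] adj_flag_closed in auto)
    then show ?thesis by simp
  qed
  have "f x = x" if x: "x \<in> Field R" for x
  proof -
    obtain B where B: "B \<in> flags R" "x \<in> B" using in_flag x by blast
    have "f x \<in> B" "face_rank R (f x) = face_rank R x"
      using fixes_flags B aut_face_rank[OF f B] by auto
    then show ?thesis using flag_face_eq[OF B(1)] B(2) by metis
  qed
  moreover have "f \<in> extensional (Field R)" using f by (simp add: aut_carrier Bij_def)
  ultimately show ?thesis unfolding aut_one by (intro extensionalityI[of _ "Field R"]) auto
qed

lemma aut_eqI:
  assumes "f \<in> carrier Aut" "g \<in> carrier Aut" "A \<in> flags R" "f ` A = g ` A"
  shows "f = g"
proof -
  interpret group Aut by (rule group_aut)
  have "(inv\<^bsub>Aut\<^esub> g \<otimes>\<^bsub>Aut\<^esub> f) ` A = A"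
    using assms aut_mult_image[of "inv\<^bsub>Aut\<^esub> g" g A] by (simp add: aut_mult_image aut_one_image)
  then have "inv\<^bsub>Aut\<^esub> g \<otimes>\<^bsub>Aut\<^esub> f = \<one>\<^bsub>Aut\<^esub>" using aut_free assms by simp
  then show ?thesis using assms by (metis inv_equality inv_inv inv_closed)
qed

lemma aut_taking_eqI:
  assumes "f \<in> carrier Aut" "A \<in> flags R" "f ` A = B"
  shows "aut_taking R A B = f"
  unfolding aut_taking_def
proof (rule the_equality)
  fix g assume "g \<in> carrier Aut \<and> g ` A = B"
  then show "g = f" using aut_eqI[of g f A] assms by simp
qed (use assms in simp)

lemma rotary_aut:
  assumes n: "2 \<le> n" and A: "A \<in> flags R"
    and s: "\<And>i. 1 \<le> i \<Longrightarrow> i < n \<Longrightarrow> s i \<in> carrier Aut"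
      "\<And>i. 1 \<le> i \<Longrightarrow> i < n \<Longrightarrow> s i ` A = adj i (adj (i - 1) A)"
  shows "rotary n (flags R) adj (Aut\<lparr>carrier := generate Aut (s ` {1..n - 1})\<rparr>) image s A"
proof -
  let ?H = "generate Aut (s ` {1..n - 1})" 
  let ?G = "Aut\<lparr>carrier := ?H\<rparr>"
  interpret Aut: group Aut by (rule group_aut)
  interpret F: polytopal_maniplex n "flags R" adj by (rule polytopal_maniplex_flags)
  have sub: "s ` {1..n - 1} \<subseteq> carrier Aut" using s(1) n by auto
  have H: "subgroup ?H Aut" by (rule Aut.generate_is_subgroup[OF sub])
  interpret G: group ?G by (rule subgroup.subgroup_is_group[OF H group_aut])
  have HA: "g \<in> carrier Aut" if "g \<in> ?H" for g using subgroup.mem_carrier[OF H that] .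
  have sH: "s i \<in> ?H" if "1 \<le> i" "i < n" for i by (rule generate.incl) (use that in auto)
  show ?thesis
  proof unfold_locales
    show "carrier ?G = generate ?G (s ` {1..n - 1})"
    proof -
      have "s ` {1..n - 1} \<subseteq> ?H" by (rule subsetI) (rule generate.incl)
      then show ?thesis using Aut.generate_consistent[OF _ H] by simp
    qed
    show "g ` B \<in> flags R" if "g \<in> carrier ?G" "B \<in> flags R" for g B
      using that aut_flag HA by simp
    show "(g \<otimes>\<^bsub>?G\<^esub> h) ` B = g ` h ` B" if "g \<in> carrier ?G" "h \<in> carrier ?G" "B \<in> flags R" for g h B
      using that aut_mult_image HA by simp
    show "\<one>\<^bsub>?G\<^esub> ` B = B" if "B \<in> flags R" for B
      using that aut_one_image by simp
    show "g ` adj c B = adj c (g ` B)" if "g \<in> carrier ?G" "B \<in> flags R" "c < n" for g B c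
      using that aut_adj HA by simp
    show "s i \<in> carrier ?G" if "1 \<le> i" "i < n" for i
      using that sH by simp
    show "conn adj {..<n} A B" if "B \<in> flags R" for B
      using that A F.connected by simp
    show "g = \<one>\<^bsub>?G\<^esub>" if "g \<in> carrier ?G" "g ` A = A" for g
      using that aut_free HA A by simp
  qed (fact n A s(2))+
qed

end

section \<open>Rotations of chiral and regular polytopes\<close>

context polytope
begin

lemma regular_\<rho>:
  assumes "regular_polytope n R" "A \<in> flags R" "c < n"
  shows "\<rho> R A c \<in> carrier Aut" "\<rho> R A c ` A = adj c A"
proof -
  obtain f where f: "f \<in> carrier Aut" "f ` A = adj c A"
    using assms adj_flag_closed[OF assms(2,3)] unfolding regular_polytope_def by blast
  then have "\<rho> R A c = f" unfolding \<rho>_def using aut_taking_eqI assms by simp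
  then show "\<rho> R A c \<in> carrier Aut" "\<rho> R A c ` A = adj c A" using f by auto
qed

lemma regular_rotation:
  assumes "regular_polytope n R" "A \<in> flags R" "1 \<le> i" "i < n"
  shows "\<rho> R A (i - 1) \<otimes>\<^bsub>Aut\<^esub> \<rho> R A i \<in> carrier Aut"
    "(\<rho> R A (i - 1) \<otimes>\<^bsub>Aut\<^esub> \<rho> R A i) ` A = adj i (adj (i - 1) A)"
proof -
  interpret group Aut by (rule group_aut)
  have i: "i - 1 < n" using assms by simp
  note p = regular_\<rho>[OF assms(1,2)]
  show "\<rho> R A (i - 1) \<otimes>\<^bsub>Aut\<^esub> \<rho> R A i \<in> carrier Aut" using p i assms by simp
  show "(\<rho> R A (i - 1) \<otimes>\<^bsub>Aut\<^esub> \<rho> R A i) ` A = adj i (adj (i - 1) A)"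
    using aut_mult_image[OF p(1)[OF i] p(1)[OF assms(4)] assms(2)] p(2) i assms aut_adj[OF p(1)[OF i]]
    by simp
qed

lemma rotary_regular:
  assumes "2 \<le> n" "regular_polytope n R" "A \<in> flags R"
  shows "rotary n (flags R) adj
    (Aut\<lparr>carrier := generate Aut ((\<lambda>i. \<rho> R A (i - 1) \<otimes>\<^bsub>Aut\<^esub> \<rho> R A i) ` {1..n - 1})\<rparr>)
    image (\<lambda>i. \<rho> R A (i - 1) \<otimes>\<^bsub>Aut\<^esub> \<rho> R A i) A"
  using assms regular_rotation by (intro rotary_aut) auto

text \<open>Rotations preserve the given parity while the reflection \<open>\<rho> R A 0\<close>
  reverses it, so the rotation group is proper; \<open>cover\<close> rules out a third
  coset.\<close>

lemma directly_regularI: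
  assumes n: "2 \<le> n" and reg: "regular_polytope n R"
    and e: "\<And>A c. c < n \<Longrightarrow> A \<in> flags R \<Longrightarrow> e (adj c A) \<longleftrightarrow> \<not> e A"
  shows "directly_regular_polytope n R"
  unfolding directly_regular_polytope_def
proof (intro conjI ballI reg)
  fix A assume A: "A \<in> flags R"
  let ?s = "\<lambda>i. \<rho> R A (i - 1) \<otimes>\<^bsub>Aut\<^esub> \<rho> R A i"
  let ?H = "generate Aut (?s ` {1..n - 1})"
  interpret Aut: group Aut by (rule group_aut)
  interpret rot: rotary n "flags R" adj "Aut\<lparr>carrier := ?H\<rparr>" image ?s A
    by (rule rotary_regular[OF n reg A])
  interpret orot: oriented_rotary n "flags R" adj "Aut\<lparr>carrier := ?H\<rparr>" image ?s A e
    by unfold_locales (rule e)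
  have "?s ` {1..n - 1} \<subseteq> carrier Aut"
    using regular_rotation(1)[OF reg A] n by auto
  then have H: "subgroup ?H Aut" by (rule Aut.generate_is_subgroup)
  have HA: "h \<in> carrier Aut" if "h \<in> ?H" for h using subgroup.mem_carrier[OF H that] .
  have n0: "0 < n" using n by simp
  note p = regular_\<rho>[OF reg A n0]
  have notin: "\<rho> R A 0 \<notin> ?H"
  proof
    assume "\<rho> R A 0 \<in> ?H"
    then have "e (\<rho> R A 0 ` A) = e A" using orot.even_flag_act[of "\<rho> R A 0" A] A by simp
    then show False using p e[OF n0 A] by simp
  qed
  have "?H #>\<^bsub>Aut\<^esub> f \<in> {?H, ?H #>\<^bsub>Aut\<^esub> \<rho> R A 0}" if f: "f \<in> carrier Aut" for f
  proof -
    obtain h where h: "h \<in> ?H" "f ` A = h ` A \<or> f ` A = h ` adj 0 A"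
      using rot.cover[OF aut_flag[OF f A] n0] by auto
    show ?thesis using h(2)
    proof
      assume "f ` A = h ` A"
      then have "f = h" using aut_eqI[OF f HA[OF h(1)] A] by simp
      then show ?thesis using Aut.coset_join2[OF f H] h by simp
    next
      assume "f ` A = h ` adj 0 A"
      then have "f ` A = (h \<otimes>\<^bsub>Aut\<^esub> \<rho> R A 0) ` A"
        using aut_mult_image[OF HA[OF h(1)] p(1) A] p(2) by simp
      then have "f = h \<otimes>\<^bsub>Aut\<^esub> \<rho> R A 0"
        using aut_eqI[OF f _ A, of "h \<otimes>\<^bsub>Aut\<^esub> \<rho> R A 0"] HA[OF h(1)] p(1) by simp
      then have "f \<in> ?H #>\<^bsub>Aut\<^esub> \<rho> R A 0" using h(1) unfolding r_coset_def by blast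
      then have "?H #>\<^bsub>Aut\<^esub> f = ?H #>\<^bsub>Aut\<^esub> \<rho> R A 0"
        using Aut.repr_independence[OF _ p(1) H, of f] by simp
      then show ?thesis by simp
    qed
  qed
  moreover have "?H \<in> rcosets\<^bsub>Aut\<^esub> ?H" using subgroup.subgroup_in_rcosets[OF H group_aut] .
  moreover have "?H #>\<^bsub>Aut\<^esub> \<rho> R A 0 \<in> rcosets\<^bsub>Aut\<^esub> ?H"
    using p(1) unfolding RCOSETS_def by blast
  ultimately have "rcosets\<^bsub>Aut\<^esub> ?H = {?H, ?H #>\<^bsub>Aut\<^esub> \<rho> R A 0}"
    unfolding RCOSETS_def by blast
  moreover have "?H \<noteq> ?H #>\<^bsub>Aut\<^esub> \<rho> R A 0"
    using notin Aut.rcos_self[OF p(1) H] by blast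
  ultimately show "card (rcosets\<^bsub>Aut\<^esub> ?H) = 2" by simp
qed

lemma orbit_self: "A \<in> flags R \<Longrightarrow> A \<in> orbit Aut image A"
  unfolding orbit_def using aut_one_image[of A] group.is_monoid[OF group_aut] monoid.one_closed
  by force

lemma orbit_image:
  assumes f: "f \<in> carrier Aut" and A: "A \<in> flags R"
  shows "orbit Aut image (f ` A) = orbit Aut image A"
proof -
  interpret group Aut by (rule group_aut)
  show ?thesis
    unfolding orbit_def
  proof (intro equalityI subsetI; clarify)
    fix g assume g: "g \<in> carrier Aut"
    show "\<exists>h. g ` f ` A = h ` A \<and> h \<in> carrier Aut"
      using aut_mult_image[OF g f A] g f by (intro exI[of _ "g \<otimes>\<^bsub>Aut\<^esub> f"]) simp
    have "(g \<otimes>\<^bsub>Aut\<^esub> inv\<^bsub>Aut\<^esub> f) ` f ` A = g ` A"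
      using aut_mult_image[of "g \<otimes>\<^bsub>Aut\<^esub> inv\<^bsub>Aut\<^esub> f" f A] g f A by (simp add: m_assoc)
    then show "\<exists>h. g ` A = h ` f ` A \<and> h \<in> carrier Aut"
      using g f by (intro exI[of _ "g \<otimes>\<^bsub>Aut\<^esub> inv\<^bsub>Aut\<^esub> f"]) simp
  qed
qed

text \<open>Each adjacency changes the orbit, and there are just two orbits, so two adjacencies lead
  back to the first one.\<close>

lemma chiral_rotation:
  assumes "chiral_polytope n R" "A \<in> flags R" "1 \<le> i" "i < n"
  shows "\<exists>f\<in>carrier Aut. f ` A = adj i (adj (i - 1) A)"
proof -
  have i: "i - 1 < n" using assms by simp
  let ?B = "adj (i - 1) A" and ?C = "adj i (adj (i - 1) A)"
  let ?O = "\<lambda>A. orbit Aut image A"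
  have F: "?B \<in> flags R" by (rule adj_flag_closed[OF assms(2) i])
  have FC: "?C \<in> flags R" by (rule adj_flag_closed[OF F assms(4)])
  have "?O A \<noteq> ?O ?B" "?O ?B \<noteq> ?O ?C"
    using assms(1) adjacent_adj_flag[OF assms(2) i] adjacent_adj_flag[OF F assms(4)]
    unfolding chiral_polytope_def by blast+
  moreover have "{?O A, ?O ?B, ?O ?C} \<subseteq> orbits Aut (flags R) image"
    using assms(2) F FC unfolding orbits_def by blast
  moreover have card: "card (orbits Aut (flags R) image) = 2"
    using assms(1) by (simp add: chiral_polytope_def)
  \<comment> \<open>Cardinality 2 is positive, hence the set of orbits is finite and
    \<open>card_mono\<close> bars three distinct ones.\<close>
  ultimately have "?O A = ?O ?C"
    using card_mono[of "orbits Aut (flags R) image" "{?O A, ?O ?B, ?O ?C}"]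
      card_gt_0_iff[of "orbits Aut (flags R) image"]
    by (cases "?O A = ?O ?C") (simp_all del: of_nat_diff)
  then have "?C \<in> ?O A" using orbit_self[OF FC] by simp
  then show ?thesis unfolding orbit_def by blast
qed

lemma chiral_not_regular:
  assumes "chiral_polytope n R" "A \<in> flags R" "0 < n"
  shows "\<not> regular_polytope n R" "f \<in> carrier Aut \<Longrightarrow> f ` A \<noteq> adj 0 A"
proof -
  show *: "f ` A \<noteq> adj 0 A" if f: "f \<in> carrier Aut" for f
  proof
    assume eq: "f ` A = adj 0 A"
    then show False
      using orbit_image[OF f assms(2)] assms(1) adjacent_adj_flag[OF assms(2,3)] unfolding chiral_polytope_def by metis
  qed
  show "\<not> regular_polytope n R"
    using * assms adj_flag_closed[OF assms(2,3)] unfolding regular_polytope_def by metis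
qed

text \<open>The second part is what orients the flags. For a chiral polytope it holds because
  adjacent flags lie in different orbits. For a directly regular one, a rotation acting on
  \<open>A\<close> like a reflection would make the rotation group all of \<open>Aut\<close>,
  against index 2.\<close>

lemma rotation_group_cover:
  assumes n: "2 \<le> n" and type: "chiral_polytope n R \<or> directly_regular_polytope n R" and A: "A \<in> flags R"
  shows "rotary n (flags R) adj (rotation_group n R A) image (\<sigma> n R A) A"
    "h \<in> carrier (rotation_group n R A) \<Longrightarrow> h ` A \<noteq> adj 0 A"
proof -
  interpret Aut: group Aut by (rule group_aut)
  have n0: "0 < n" using n by simp
  have \<sigma>: "\<sigma> n R A i \<in> carrier Aut \<and> \<sigma> n R A i ` A = adj i (adj (i - 1) A)" if i: "1 \<le> i" "i < n" for i
  proof (cases "regular_polytope n R")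
    case True
    then show ?thesis using regular_rotation[OF True A i] by (simp add: \<sigma>_def)
  next
    case False
    then have "chiral_polytope n R" using type by (auto simp: directly_regular_polytope_def)
    then obtain f where f: "f \<in> carrier Aut" "f ` A = adj i (adj (i - 1) A)"
      using chiral_rotation A i by blast
    have "\<sigma> n R A i = f"
      using aut_taking_eqI[OF f(1) A f(2)] False i by (simp add: \<sigma>_def of_nat_diff)
    then show ?thesis using f by simp
  qed
  show rot: "rotary n (flags R) adj (rotation_group n R A) image (\<sigma> n R A) A"
    unfolding rotation_group_def by (rule rotary_aut) (use n A \<sigma> in auto)
  let ?H = "generate Aut (\<sigma> n R A ` {1..n - 1})"
  have "\<sigma> n R A ` {1..n - 1} \<subseteq> carrier Aut" using \<sigma> n by auto
  then have H: "subgroup ?H Aut" by (rule Aut.generate_is_subgroup)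
  have cG: "carrier (rotation_group n R A) = ?H" by (simp add: rotation_group_def)
  have HA: "h \<in> carrier Aut" if "h \<in> ?H" for h using subgroup.mem_carrier[OF H that] .
  show "h ` A \<noteq> adj 0 A" if h: "h \<in> carrier (rotation_group n R A)"
  proof (cases "chiral_polytope n R")
    case True
    then show ?thesis using chiral_not_regular(2)[OF True A n0] HA h cG by simp
  next
    case False
    then have dr: "directly_regular_polytope n R" using type by simp
    then have reg: "regular_polytope n R" by (simp add: directly_regular_polytope_def)
    have "\<sigma> n R A ` {1..n - 1} = (\<lambda>i. \<rho> R A (i - 1) \<otimes>\<^bsub>Aut\<^esub> \<rho> R A i) ` {1..n - 1}"
      by (rule image_cong) (use reg in \<open>auto simp: \<sigma>_def\<close>)
    then have card: "card (rcosets\<^bsub>Aut\<^esub> ?H) = 2"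
      using dr A unfolding directly_regular_polytope_def by simp
    show ?thesis
    proof
      assume eq: "h ` A = adj 0 A"
      have "f \<in> ?H" if f: "f \<in> carrier Aut" for f
      proof -
        obtain k where k: "k \<in> ?H" "f ` A = k ` A \<or> f ` A = k ` adj 0 A"
          using rotary.cover[OF rot aut_flag[OF f A] n0] cG by auto
        have "f ` A = k ` A \<or> f ` A = (k \<otimes>\<^bsub>Aut\<^esub> h) ` A"
          using k(2) eq aut_mult_image[OF HA[OF k(1)] HA A] h cG by simp
        then have "f = k \<or> f = k \<otimes>\<^bsub>Aut\<^esub> h"
          using aut_eqI[OF f _ A] HA k(1) h cG by auto
        then show ?thesis using k(1) h cG subgroup.m_closed[OF H] by auto
      qed
      then have "rcosets\<^bsub>Aut\<^esub> ?H \<subseteq> {?H}"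
        using Aut.coset_join2[OF _ H] unfolding RCOSETS_def by auto
      then have "card (rcosets\<^bsub>Aut\<^esub> ?H) \<le> 1" using card_mono[of "{?H}"] by fastforce
      then show False using card by simp
    qed
  qed
qed

lemma oriented_rotary_flags:
  assumes "2 \<le> n" "chiral_polytope n R \<or> directly_regular_polytope n R" "A \<in> flags R"
  shows "\<exists>e. oriented_rotary n (flags R) adj (rotation_group n R A) image (\<sigma> n R A) A e"
proof -
  interpret rotary n "flags R" adj "rotation_group n R A" image "\<sigma> n R A" A
    by (rule rotation_group_cover(1)[OF assms])
  have "oriented_rotary n (flags R) adj (rotation_group n R A) image (\<sigma> n R A) A
      (\<lambda>B. \<exists>h\<in>carrier (rotation_group n R A). B = h ` A)"
    by unfold_locales (rule orientation_exists[OF rotation_group_cover(2)[OF assms]])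
  then show ?thesis by blast
qed

end

section \<open>The coset poset\<close>

locale rotary_polytope = polytopal_maniplex n F r + oriented_rotary n F r G act s x0 even_flag
  for n and F :: "'x set" and r and G :: "('g, 'm) monoid_scheme" (structure)
    and act s x0 even_flag
begin

definition stab :: "int \<Rightarrow> 'g set" where
  "stab i = \<Gamma> G n s ({-1..int n} - {i})"

text \<open>The component of \<open>x\<close> without colour \<open>i\<close> is recorded by its
  even flags, each named by the unique group element taking \<open>x0\<close> there. At
  \<open>x0\<close> this is the stabilizer, at \<open>act g x0\<close> its left coset; an odd
  \<open>x\<close> yields such a coset too.\<close>

definition coset_face :: "int \<Rightarrow> 'x \<Rightarrow> int \<times> 'g set" where
  "coset_face i x = (i, {m \<in> carrier G. conn r (other_ranks n i) x (act m x0)})"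

lemma colours_stab: "colours ({-1..int n} - {i}) = other_ranks n i"
  by (auto simp: colours_def other_ranks_def)

lemma even_orbitD:
  assumes "x \<in> F" "even_flag x = even_flag x0"
  shows "\<exists>h\<in>carrier G. x = act h x0"
  using even_orbit assms by blast

text \<open>An odd flag becomes even after one step, so a single colour in \<open>I\<close> is
  enough.\<close>

lemma even_rep:
  assumes x: "x \<in> F" and c: "c < n" "c \<in> I"
  shows "\<exists>m\<in>carrier G. conn r I x (act m x0)"
proof (cases "even_flag x = even_flag x0")
  case True
  then obtain m where "m \<in> carrier G" "x = act m x0" using even_orbitD x by blast
  then show ?thesis using conn_refl[of r I x] by auto
next
  case False
  then have "even_flag (r c x) = even_flag x0" using even_flag_r x c by simp
  then obtain m where "m \<in> carrier G" "r c x = act m x0" using even_orbitD[of "r c x"] x c r_closed by blast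
  then show ?thesis using conn_single[OF c(2), of r x] by auto
qed

lemma conn_equiv:
  assumes "x \<in> F" "y \<in> F" "I \<subseteq> {..<n}" "conn r I x y"
  shows "conn r I x z \<longleftrightarrow> conn r I y z"
  using conn_trans[of r I y z x] conn_trans[of r I x z y] conn_sym assms by blast

text \<open>Rank at least 2 leaves a colour after the deletion of one; it is needed to pass from an
  odd flag to an even one inside a component.\<close>

lemma other_ranks_nonempty: "\<exists>c. c < n \<and> c \<in> other_ranks n i"
proof (cases "i = 0")
  case True
  then show ?thesis using two_le by (intro exI[of _ 1]) (auto simp: other_ranks_def)
next
  case False
  then show ?thesis using two_le by (intro exI[of _ 0]) (auto simp: other_ranks_def)
qed

lemma coset_face_memD:
  assumes "m \<in> snd (coset_face i x)" "x \<in> F"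
  shows "m \<in> carrier G" "coset_face i x = coset_face i (act m x0)"
proof -
  have m: "m \<in> carrier G" "conn r (other_ranks n i) x (act m x0)"
    using assms by (auto simp: coset_face_def)
  then have "act m x0 \<in> F" using act_closed x0 by simp
  then show "coset_face i x = coset_face i (act m x0)"
    using conn_equiv[OF assms(2) _ other_ranks_subset m(2)] by (simp add: coset_face_def)
qed (use assms in \<open>simp add: coset_face_def\<close>)

lemma coset_face_rep:
  assumes "x \<in> F"
  shows "\<exists>m\<in>carrier G. coset_face i x = coset_face i (act m x0)"
proof -
  obtain c where c: "c < n" "c \<in> other_ranks n i" using other_ranks_nonempty by blast
  obtain m where "m \<in> carrier G" "conn r (other_ranks n i) x (act m x0)" using even_rep[OF assms c] by blast
  then have "m \<in> snd (coset_face i x)" by (simp add: coset_face_def)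
  then show ?thesis using coset_face_memD assms by blast
qed

text \<open>The set of even flags determines its component because it is never empty.\<close>

lemma coset_face_eq_iff:
  assumes x: "x \<in> F" and y: "y \<in> F"
  shows "coset_face i x = coset_face j y \<longleftrightarrow> i = j \<and> conn r (other_ranks n i) x y"
proof
  assume eq: "coset_face i x = coset_face j y"
  then have ij: "i = j" by (simp add: coset_face_def)
  obtain c where c: "c < n" "c \<in> other_ranks n i" using other_ranks_nonempty by blast
  obtain m where m: "m \<in> carrier G" "conn r (other_ranks n i) x (act m x0)" using even_rep[OF x c] by blast
  then have "conn r (other_ranks n i) y (act m x0)" using eq ij by (auto simp: coset_face_def)
  then have "conn r (other_ranks n i) (act m x0) y" using conn_sym y other_ranks_subset by blast
  then show "i = j \<and> conn r (other_ranks n i) x y" using ij conn_trans[OF _ m(2)] by simp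
next
  assume "i = j \<and> conn r (other_ranks n i) x y"
  then show "coset_face i x = coset_face j y"
    using conn_equiv[OF x y other_ranks_subset] by (auto simp: coset_face_def)
qed

sublocale face_poset n F r coset_face
  by unfold_locales (use coset_face_eq_iff x0 in auto)

section \<open>Cosets of face stabilizers and their incidence\<close>

lemma stab_iff: "g \<in> carrier G \<Longrightarrow> g \<in> stab i \<longleftrightarrow> conn r (other_ranks n i) x0 (act g x0)"
  unfolding stab_def Gamma_iff colours_stab ..

lemma conn_act_iff:
  assumes "g \<in> carrier G" "x \<in> F" "y \<in> F" "I \<subseteq> {..<n}"
  shows "conn r I (act g x) (act g y) \<longleftrightarrow> conn r I x y"
proof
  assume "conn r I (act g x) (act g y)"
  then have "conn r I (act (inv g) (act g x)) (act (inv g) (act g y))"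
    using act_conn[of I "act g x" "act g y" "inv g"] act_closed assms by simp
  then show "conn r I x y" using act_inv assms by simp
qed (use act_conn assms in blast)

lemma coset_face_act:
  assumes g: "g \<in> carrier G" and x: "x \<in> F"
  shows "coset_face i (act g x) = (i, (\<lambda>m. g \<otimes> m) ` snd (coset_face i x))"
proof -
  have "{m \<in> carrier G. conn r (other_ranks n i) (act g x) (act m x0)} =
      (\<lambda>m. g \<otimes> m) ` {m \<in> carrier G. conn r (other_ranks n i) x (act m x0)}" (is "?L = ?R")
  proof (intro equalityI subsetI)
    fix m assume "m \<in> ?L"
    then have m: "m \<in> carrier G" "conn r (other_ranks n i) (act g x) (act m x0)" by auto
    have "g \<otimes> (inv g \<otimes> m) = m" using g m by (simp add: m_assoc[symmetric])
    moreover have "conn r (other_ranks n i) x (act (inv g \<otimes> m) x0)"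
    proof -
      have "act g (act (inv g \<otimes> m) x0) = act m x0"
        using act_mult[of g "inv g \<otimes> m" x0] g m x0 \<open>g \<otimes> (inv g \<otimes> m) = m\<close> by simp
      then show ?thesis
        using conn_act_iff[OF g x, of "act (inv g \<otimes> m) x0"] g m x0 act_closed by simp
    qed
    ultimately show "m \<in> ?R" using g m(1) by (intro image_eqI[of _ _ "inv g \<otimes> m"]) auto
  next
    fix m assume "m \<in> ?R"
    then obtain k where k: "m = g \<otimes> k" "k \<in> carrier G" "conn r (other_ranks n i) x (act k x0)" by auto
    then show "m \<in> ?L" using conn_act_iff[OF g x, of "act k x0"] act_mult g x0 act_closed by simp
  qed
  then show ?thesis by (simp add: coset_face_def)
qed

lemma coset_face_x0: "coset_face i x0 = (i, stab i)"
proof -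
  have "stab i \<subseteq> carrier G" using Gamma_closed by (auto simp: stab_def)
  then show ?thesis using stab_iff by (auto simp: coset_face_def)
qed

lemma coset_face_lcoset:
  assumes "g \<in> carrier G"
  shows "coset_face i (act g x0) = (i, g <# stab i)"
  using coset_face_act[OF assms x0] coset_face_x0 by (auto simp: l_coset_def)

lemma coset_faces_eq: "coset_faces G n s = {coset_face i x | i x. i \<in> {-1..int n} \<and> x \<in> F}"
proof (intro equalityI subsetI)
  fix a assume "a \<in> coset_faces G n s"
  then obtain i g where a: "a = (i, g <# stab i)" "i \<in> {-1..int n}" "g \<in> carrier G"
    by (auto simp: coset_faces_def LCOSETS_def stab_def)
  then have "a = coset_face i (act g x0)" "act g x0 \<in> F"
    using coset_face_lcoset act_closed x0 by auto
  then show "a \<in> {coset_face i x | i x. i \<in> {-1..int n} \<and> x \<in> F}" using a by blast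
next
  fix a assume "a \<in> {coset_face i x | i x. i \<in> {-1..int n} \<and> x \<in> F}"
  then obtain i x where a: "a = coset_face i x" "i \<in> {-1..int n}" "x \<in> F" by blast
  obtain g where "g \<in> carrier G" "a = (i, g <# stab i)"
    using coset_face_rep[OF a(3), of i] coset_face_lcoset a(1) by auto
  then show "a \<in> coset_faces G n s" using a(2) by (auto simp: coset_faces_def LCOSETS_def stab_def)
qed

text \<open>Right multiplication by \<open>s 1\<close>, as in the polygon clause of
  \<open>coset_poset\<close>, amounts to two colour steps from the flag of \<open>g\<close>.\<close>

lemma polygon_incidence:
  assumes g: "g \<in> carrier G"
  shows "act (g \<otimes> s 1) x0 = r 1 (r 0 (act g x0))"
  using act_mult[OF g s_closed x0, of 1] act_s[of 1] act_r[OF g] r_closed[OF _ x0, of 0] x0 two_le by simp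

text \<open>Two cosets meet when some even flag contains both faces. If the faces lie in a common
  flag, a colour different from both ranks corrects its parity; only vertex and edge of a polygon
  leave no such colour, hence the extra clause in \<open>coset_poset\<close>.\<close>

lemma coset_poset_eq: "coset_poset G n s = face_order"
proof (intro equalityI subsetI)
  fix ab assume "ab \<in> coset_poset G n s"
  moreover obtain i A j B where ab1: "ab = ((i, A), (j, B))" by (metis surj_pair)
  ultimately have ab: "ab = ((i, A), (j, B))" "(i, A) \<in> coset_faces G n s"
    "(j, B) \<in> coset_faces G n s" "i \<le> j"
    "A \<inter> B \<noteq> {} \<or> n = 2 \<and> i = 0 \<and> j = 1 \<and> (\<exists>g \<in> B. g \<otimes> s 1 \<in> A)"
    by (simp_all add: coset_poset_def)
  obtain x where x: "x \<in> F" "(i, A) = coset_face i x" "i \<in> {-1..int n}"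
    using ab(2) unfolding coset_faces_eq by (auto simp: coset_face_def)
  obtain y where y: "y \<in> F" "(j, B) = coset_face j y" "j \<in> {-1..int n}"
    using ab(3) unfolding coset_faces_eq by (auto simp: coset_face_def)
  have A: "A = snd (coset_face i x)" and B: "B = snd (coset_face j y)" using x(2) y(2) by (metis snd_conv)+
  have "\<exists>z\<in>F. (i, A) = coset_face i z \<and> (j, B) = coset_face j z"
    using ab(5)
  proof
    assume "A \<inter> B \<noteq> {}"
    then obtain m where m: "m \<in> A" "m \<in> B" by blast
    then have "m \<in> carrier G" "(i, A) = coset_face i (act m x0)" "(j, B) = coset_face j (act m x0)"
      using coset_face_memD[of m i x] coset_face_memD[of m j y] x y A B by auto
    then show ?thesis using act_closed x0 by blast
  next
    assume "n = 2 \<and> i = 0 \<and> j = 1 \<and> (\<exists>g \<in> B. g \<otimes> s 1 \<in> A)"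
    then obtain g where g: "n = 2" "i = 0" "j = 1" "g \<in> B" "g \<otimes> s 1 \<in> A" by blast
    then have gG: "g \<in> carrier G" "(j, B) = coset_face j (act g x0)"
      using coset_face_memD[of g j y] y B by auto
    have iA: "(i, A) = coset_face i (act (g \<otimes> s 1) x0)"
      using coset_face_memD[of "g \<otimes> s 1" i x] x A g by auto
    \<comment> \<open>This odd flag contains the edge of \<open>g\<close>, since colour 0 fixes
      edges. One step of colour 1 fixes its vertex and reaches the flag of
      \<open>g \<otimes> s 1\<close>.\<close>
    let ?z = "r 0 (act g x0)"
    have z: "?z \<in> F" using r_closed act_closed gG x0 g by simp
    have "coset_face j ?z = coset_face j (act g x0)"
      using fc_step[of 0 j "act g x0"] act_closed gG x0 g by simp
    moreover have "coset_face i (r 1 ?z) = coset_face i ?z"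
      using fc_step[of 1 i ?z] z g by simp
    ultimately show ?thesis using iA gG polygon_incidence z by auto
  qed
  then obtain z where "z \<in> F" "(i, A) = coset_face i z" "(j, B) = coset_face j z" by blast
  then show "ab \<in> face_order" using face_orderI[of z i j] ab(1,4) x(3) y(3) by simp
next
  fix ab assume "ab \<in> face_order"
  then obtain a b where "ab = (a, b)" "(a, b) \<in> face_order" by (cases ab) auto
  then obtain x i j where x: "x \<in> F" "-1 \<le> i" "i \<le> j" "j \<le> int n" "ab = (coset_face i x, coset_face j x)"
    by (auto elim: face_orderE)
  define A where "A = snd (coset_face i x)"
  define B where "B = snd (coset_face j x)"
  have AB: "coset_face i x = (i, A)" "coset_face j x = (j, B)" by (auto simp: A_def B_def coset_face_def)
  have faces: "(i, A) \<in> coset_faces G n s" "(j, B) \<in> coset_faces G n s"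
  proof -
    have "i \<in> {-1..int n}" "j \<in> {-1..int n}" using x by auto
    then show "(i, A) \<in> coset_faces G n s" "(j, B) \<in> coset_faces G n s"
      unfolding coset_faces_eq AB[symmetric] using x(1) by blast+
  qed
  have "A \<inter> B \<noteq> {} \<or> n = 2 \<and> i = 0 \<and> j = 1 \<and> (\<exists>g \<in> B. g \<otimes> s 1 \<in> A)"
  proof (cases "\<exists>c. c < n \<and> c \<in> other_ranks n i \<inter> other_ranks n j")
    case True
    then obtain c where c: "c < n" "c \<in> other_ranks n i \<inter> other_ranks n j" by blast
    obtain m where m: "m \<in> carrier G" "conn r (other_ranks n i \<inter> other_ranks n j) x (act m x0)"
      using even_rep[OF x(1) c] by blast
    then have "m \<in> A \<inter> B"
      using conn_mono[OF m(2), of "other_ranks n i"] conn_mono[OF m(2), of "other_ranks n j"]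
      by (auto simp: A_def B_def coset_face_def)
    then show ?thesis by blast
  next
    case False
    have "n = 2 \<and> i = 0 \<and> j = 1"
    proof -
      have *: "int c = i \<or> int c = j" if "c < n" for c using False that by (auto simp: other_ranks_def)
      \<comment> \<open>Three colours cannot all lie among the two ranks \<open>i\<close> and
        \<open>j\<close>.\<close>
      have "\<not> 2 < n" using *[of 0] *[of 1] *[of 2] by auto
      then have "n = 2" using two_le by simp
      then show ?thesis using *[of 0] *[of 1] x(3) by auto
    qed
    then have n: "n = 2" "i = 0" "j = 1" by auto
    show ?thesis
    proof (cases "even_flag x = even_flag x0")
      case True
      then obtain m where "m \<in> carrier G" "x = act m x0" using even_orbitD x by blast
      then have "m \<in> A \<inter> B" using conn_refl[of r _ x] by (auto simp: A_def B_def coset_face_def)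
      then show ?thesis by blast
    next
      case False
      \<comment> \<open>The odd flag \<open>x\<close> has two even neighbours: \<open>r 0 x\<close>
        shares its edge and \<open>r 1 x\<close> its vertex, and right multiplication by
        \<open>s 1\<close> leads from the first to the second.\<close>
      then have "even_flag (r 0 x) = even_flag x0" using even_flag_r x n by simp
      then obtain g where g: "g \<in> carrier G" "r 0 x = act g x0"
        using even_orbitD[of "r 0 x"] r_closed x n by auto
      have "conn r (other_ranks n j) x (r 0 x)"
        by (rule conn_single) (use n in \<open>auto simp: other_ranks_def\<close>)
      then have gB: "g \<in> B" using g by (simp add: B_def coset_face_def)
      have "conn r (other_ranks n i) x (r 1 x)"
        by (rule conn_single) (use n in \<open>auto simp: other_ranks_def\<close>)
      moreover have "act (g \<otimes> s 1) x0 = r 1 x"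
        using polygon_incidence[OF g(1)] g(2)[symmetric] r_invol x n by simp
      moreover have "g \<otimes> s 1 \<in> carrier G" using g(1) s_closed[of 1] two_le by simp
      ultimately have "g \<otimes> s 1 \<in> A" unfolding A_def coset_face_def by simp
      then show ?thesis using gB n by blast
    qed
  qed
  then show "ab \<in> coset_poset G n s" using faces x(3,5) AB by (auto simp: coset_poset_def)
qed

sublocale polytope n face_order
  by unfold_locales (rule abstract_polytope_face_order)

section \<open>Automorphisms of the coset poset and their orbits on flags\<close>

lemma adj_flag_of: "x \<in> F \<Longrightarrow> c < n \<Longrightarrow> adj_flag face_order (int c) (flag_of x) = flag_of (r c x)"
  by (rule adj_flag_eqI[OF adjacent_flag_of])

text \<open>Left translation of cosets is how \<open>g\<close> acts on the poset; restricting it to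
  \<open>Field face_order\<close> meets the extensionality demanded by
  \<open>aut_group\<close>.\<close>

definition translate :: "'g \<Rightarrow> int \<times> 'g set \<Rightarrow> int \<times> 'g set" where
  "translate g = (\<lambda>a\<in>Field face_order. (fst a, (\<lambda>m. g \<otimes> m) ` snd a))"

lemma coset_face_in_Field: "x \<in> F \<Longrightarrow> -1 \<le> i \<Longrightarrow> i \<le> int n \<Longrightarrow> coset_face i x \<in> Field face_order"
  by (auto simp: Field_face_order)

lemma translate_coset_face:
  assumes "g \<in> carrier G" "x \<in> F" "-1 \<le> i" "i \<le> int n"
  shows "translate g (coset_face i x) = coset_face i (act g x)"
proof -
  have "fst (coset_face i x) = i" by (simp add: coset_face_def)
  then show ?thesis
    using coset_face_act[OF assms(1,2), of i] coset_face_in_Field[OF assms(2-4)]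
    by (simp add: translate_def)
qed

lemma translate_closed:
  assumes "g \<in> carrier G" "a \<in> Field face_order"
  shows "translate g a \<in> Field face_order"
proof -
  obtain i x where "a = coset_face i x" "x \<in> F" "-1 \<le> i" "i \<le> int n"
    using assms(2) by (auto simp: Field_face_order)
  then show ?thesis using translate_coset_face act_closed coset_face_in_Field assms(1) by simp
qed

lemma translate_inv:
  assumes "g \<in> carrier G" "a \<in> Field face_order"
  shows "translate (inv g) (translate g a) = a"
proof -
  obtain i x where "a = coset_face i x" "x \<in> F" "-1 \<le> i" "i \<le> int n"
    using assms(2) by (auto simp: Field_face_order)
  then show ?thesis using translate_coset_face act_closed act_inv assms(1) by simp
qed

lemma translate_rel:
  assumes "g \<in> carrier G" "(a, b) \<in> face_order"
  shows "(translate g a, translate g b) \<in> face_order"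
proof -
  obtain x i j where "x \<in> F" "-1 \<le> i" "i \<le> j" "j \<le> int n" "a = coset_face i x" "b = coset_face j x"
    using assms(2) by (rule face_orderE)
  then show ?thesis using translate_coset_face act_closed face_orderI assms(1) by simp
qed

lemma translate_aut:
  assumes g: "g \<in> carrier G"
  shows "translate g \<in> carrier (aut_group face_order)"
proof -
  have inv2: "translate g (translate (inv g) a) = a" if "a \<in> Field face_order" for a
    using translate_inv[of "inv g" a] g that by simp
  have "bij_betw (translate g) (Field face_order) (Field face_order)"
    by (rule bij_betw_byWitness[where f' = "translate (inv g)"])
      (use translate_inv translate_closed inv2 g in auto)
  moreover have "translate g \<in> extensional (Field face_order)" by (simp add: translate_def)
  moreover have "(translate g a, translate g b) \<in> face_order \<longleftrightarrow> (a, b) \<in> face_order"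
    if "a \<in> Field face_order" "b \<in> Field face_order" for a b
    using translate_rel[OF g, of a b] translate_rel[of "inv g" "translate g a" "translate g b"]
      translate_inv g that by auto
  ultimately show ?thesis unfolding aut_carrier Bij_def by blast
qed

lemma translate_flag_of:
  assumes "g \<in> carrier G" "x \<in> F"
  shows "translate g ` flag_of x = flag_of (act g x)"
proof -
  have "(translate g \<circ> (\<lambda>i. coset_face i x)) ` {-1..int n} = (\<lambda>i. coset_face i (act g x)) ` {-1..int n}"
    by (rule image_cong) (use translate_coset_face assms in auto)
  then show ?thesis unfolding flag_of_def image_comp .
qed

lemma orbit_act:
  assumes "g \<in> carrier G" "x \<in> F"
  shows "orbit Aut image (flag_of (act g x)) = orbit Aut image (flag_of x)"
  using orbit_image[OF translate_aut[OF assms(1)], of "flag_of x"] translate_flag_of[OF assms]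
    flags_face_order assms by simp

text \<open>Translations already identify flags of equal parity, so \<open>Aut\<close> has at most
  two orbits, represented by \<open>x0\<close> and \<open>r 0 x0\<close>.\<close>

lemma orbit_of_flag:
  assumes "x \<in> F"
  shows "orbit Aut image (flag_of x) =
    orbit Aut image (flag_of (if even_flag x = even_flag x0 then x0 else r 0 x0))"
proof -
  have n: "0 < n" using two_le by simp
  obtain h where h: "h \<in> carrier G" "x = act h x0 \<or> x = act h (r 0 x0)" using cover[OF assms n] by blast
  then show ?thesis
    using orbit_act[OF h(1)] even_flag_act[OF h(1)] even_flag_r[OF n x0] r_closed[OF n x0] x0 by auto
qed

text \<open>Either \<open>Aut\<close> keeps the two parity classes apart and the poset is chiral, or
  it merges them and the poset is regular; in the latter case parity gives index 2.\<close>

theorem coset_poset_polytope: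
  "chiral_polytope n (coset_poset G n s) \<or> directly_regular_polytope n (coset_poset G n s)"
proof -
  let ?O = "\<lambda>x. orbit Aut image (flag_of x)"
  have n: "0 < n" using two_le by simp
  note rx0 = r_closed[OF n x0]
  show ?thesis
  proof (cases "?O x0 = ?O (r 0 x0)")
    case False
    have "orbits Aut (flags face_order) image = {?O x0, ?O (r 0 x0)}"
    proof
      show "orbits Aut (flags face_order) image \<subseteq> {?O x0, ?O (r 0 x0)}"
      proof -
        have "?O x = ?O x0 \<or> ?O x = ?O (r 0 x0)" if "x \<in> F" for x
          using orbit_of_flag[OF that] by (cases "even_flag x = even_flag x0") simp_all
        then show ?thesis unfolding orbits_def flags_face_order by blast
      qed
      show "{?O x0, ?O (r 0 x0)} \<subseteq> orbits Aut (flags face_order) image"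
        unfolding orbits_def flags_face_order using x0 rx0 by blast
    qed
    then have "card (orbits Aut (flags face_order) image) = 2" using False by simp
    moreover have "orbit Aut image A \<noteq> orbit Aut image B" if adj: "adjacent face_order i A B" for i A B
    proof -
      define c where "c = nat i"
      have c: "i = int c" "c < n" using adjacent_rank[OF adj] by (auto simp: c_def)
      obtain x where x: "x \<in> F" "A = flag_of x" using adj by (auto simp: adjacent_def flags_face_order)
      have "B = flag_of (r c x)" using adj_flag_eqI[of c A B] adj_flag_of[OF x(1) c(2)] adj c x by simp
      then show ?thesis
        using orbit_of_flag[OF x(1)] orbit_of_flag[OF r_closed[OF c(2) x(1)]] even_flag_r[OF c(2) x(1)] x(2) False
        by (auto split: if_splits)
    qed
    ultimately have "chiral_polytope n face_order"
      unfolding chiral_polytope_def using abstract_polytope_face_order by blast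
    then show ?thesis unfolding coset_poset_eq by simp
  next
    case True
    have same: "?O x = ?O x0" if "x \<in> F" for x
      using orbit_of_flag[OF that] True by (simp split: if_splits)
    have "\<exists>f\<in>carrier Aut. f ` A = B" if AB: "A \<in> flags face_order" "B \<in> flags face_order" for A B
    proof -
      have "orbit Aut image A = orbit Aut image B" using same AB by (auto simp: flags_face_order)
      then have "B \<in> orbit Aut image A" using orbit_self AB by blast
      then show ?thesis by (auto simp: orbit_def)
    qed
    then have reg: "regular_polytope n face_order"
      unfolding regular_polytope_def using abstract_polytope_face_order by blast
    have inj: "inj_on flag_of F" using flag_of_inj by (auto intro: inj_onI)
    have "directly_regular_polytope n face_order"
    proof (rule directly_regularI[OF two_le reg])
      fix A c assume c: "c < n" and "A \<in> flags face_order"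
      then obtain x where x: "x \<in> F" "A = flag_of x" by (auto simp: flags_face_order)
      \<comment> \<open>Parity lives on \<open>F\<close>; \<open>inv_into\<close> transports it to
        the flags of the poset along the injection \<open>flag_of\<close>.\<close>
      then show "even_flag (inv_into F flag_of (adj c A)) \<longleftrightarrow> \<not> even_flag (inv_into F flag_of A)"
        using adj_flag_of[OF x(1) c] inv_into_f_f[OF inj] r_closed[OF c x(1)] even_flag_r[OF c x(1)] by simp
    qed
    then show ?thesis unfolding coset_poset_eq by simp
  qed
qed

end

section \<open>The mix\<close>

lemma funpow_period:
  assumes "(f ^^ p) x = x"
  shows "(f ^^ (p * k)) x = x"
proof -
  have "((f ^^ p) ^^ k) x = x" by (induction k) (use assms in auto)
  then show ?thesis by (simp add: funpow_mult)
qed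

text \<open>The congruence becomes an equation of natural numbers with multiples of \<open>q\<close>
  on both sides, which avoids subtraction. For \<open>q = 0\<close> it says \<open>e = 1\<close>, so
  infinite order is covered.\<close>

lemma funpow_cong:
  assumes "(f ^^ q) x = x" "[e = 1] (mod q)"
  shows "(f ^^ e) x = f x"
proof -
  obtain a b where ab: "e + q * a = 1 + q * b"
    using assms(2) unfolding cong_iff_lin_nat by (metis mult.commute)
  have "(f ^^ e) x = (f ^^ (e + q * a)) x" using funpow_period[OF assms(1)] by (simp add: funpow_add)
  also have "\<dots> = (f ^^ 1) ((f ^^ (q * b)) x)" unfolding ab funpow_add by simp
  also have "\<dots> = f x" using funpow_period[OF assms(1)] by simp
  finally show ?thesis .
qed

locale rotary_pair =
  P: rotary_polytope n F1 r1 G1 act1 s1 x1 even1 + Q: rotary_polytope n F2 r2 G2 act2 s2 x2 even2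
  for n and F1 :: "'x set" and r1 and G1 :: "('g, 'm) monoid_scheme" and act1 s1 x1 even1
    and F2 :: "'y set" and r2 and G2 :: "('h, 'k) monoid_scheme" and act2 s2 x2 even2 +
  assumes coprime_periods: "i \<in> {2..n - 2} \<Longrightarrow> coprime (group.ord G1 (s1 i)) (group.ord G2 (s2 i))"
begin

definition pair_r :: "nat \<Rightarrow> 'x \<times> 'y \<Rightarrow> 'x \<times> 'y" where
  "pair_r c z = (r1 c (fst z), r2 c (snd z))"

definition pair_act :: "'g \<times> 'h \<Rightarrow> 'x \<times> 'y \<Rightarrow> 'x \<times> 'y" where
  "pair_act g z = (act1 (fst g) (fst z), act2 (snd g) (snd z))"

text \<open>The component of the base pair is taken because the full product falls apart, by parity
  at least.\<close>

definition pair_flags :: "('x \<times> 'y) set" where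
  "pair_flags = {z. conn pair_r {..<n} (x1, x2) z}"

definition pair_gen :: "nat \<Rightarrow> 'g \<times> 'h" where
  "pair_gen i = (s1 i, s2 i)"

definition pair_group :: "('g \<times> 'h) monoid" where
  "pair_group = (G1 \<times>\<times> G2)\<lparr>carrier := generate (G1 \<times>\<times> G2) (pair_gen ` {1..n - 1})\<rparr>"

sublocale prod: flag_system n "F1 \<times> F2" pair_r
  by unfold_locales (auto simp: pair_r_def P.r_closed Q.r_closed P.r_invol Q.r_invol)

lemma conn_fst: "conn pair_r I z w \<Longrightarrow> conn r1 I (fst z) (fst w)"
  by (induction rule: conn.induct) (auto simp: pair_r_def intro: conn_refl conn_step[of r1])

lemma conn_snd: "conn pair_r I z w \<Longrightarrow> conn r2 I (snd z) (snd w)"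
  by (induction rule: conn.induct) (auto simp: pair_r_def intro: conn_refl conn_step[of r2])

lemma conn_lift: "conn r1 I A A' \<Longrightarrow> \<exists>B'. conn pair_r I (A, B) (A', B')"
proof (induction rule: conn.induct)
  case conn_refl
  then show ?case using conn.conn_refl[of pair_r I "(A, B)"] by blast
next
  case (conn_step A' c)
  then obtain B' where "conn pair_r I (A, B) (A', B')" by blast
  then have "conn pair_r I (A, B) (pair_r c (A', B'))" using conn_step(2) by (rule conn.conn_step)
  then have "conn pair_r I (A, B) (r1 c A', r2 c B')" unfolding pair_r_def[of c] by simp
  then show ?case by blast
qed

text \<open>Each step flips both parities. This forces the later correction in the second component
  to be even.\<close>

lemma parity_conn:
  assumes "conn pair_r I z w" "I \<subseteq> {..<n}" "z \<in> F1 \<times> F2"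
  shows "(even1 (fst w) = even1 (fst z)) = (even2 (snd w) = even2 (snd z))"
  using assms(1)
proof (induction rule: conn.induct)
  case (conn_step w c)
  have "w \<in> F1 \<times> F2" using prod.conn_closed[OF conn_step(1)] assms by simp
  moreover have "c < n" using conn_step(2) assms by auto
  ultimately show ?case using conn_step.IH P.even_flag_r Q.even_flag_r by (auto simp: pair_r_def)
qed simp

lemma conn_funpow:
  assumes "\<And>z. conn pair_r I z (f z)"
  shows "conn pair_r I z ((f ^^ e) z)"
proof (induction e)
  case 0
  then show ?case using conn_refl[of pair_r I z] by simp
next
  case (Suc e)
  then show ?case using conn_trans[OF assms[of "(f ^^ e) z"] Suc] by simp
qed

text \<open>
  By the Chinese remainder theorem a power of the rotation of the mix acts as a rotation on one
  of the two components and trivially on the other.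
\<close>

lemma rotate_second:
  assumes k: "k \<in> {2..n - 2}" "k - 1 \<in> K" "k \<in> K" and A: "A \<in> F1" and B: "B \<in> F2"
  shows "conn pair_r K (A, B) (A, r2 k (r2 (k - 1) B))"
proof -
  let ?p = "group.ord G1 (s1 k)" and ?q = "group.ord G2 (s2 k)"
  obtain e where e: "[e = 0] (mod ?p)" "[e = 1] (mod ?q)"
    using binary_chinese_remainder_nat[OF coprime_periods[OF k(1)]] by blast
  define w where "w z = pair_r k (pair_r (k - 1) z)" for z
  define w1 where "w1 = (\<lambda>x. r1 k (r1 (k - 1) x))"
  define w2 where "w2 = (\<lambda>x. r2 k (r2 (k - 1) x))"
  have w: "(w ^^ m) (A, B) = ((w1 ^^ m) A, (w2 ^^ m) B)" for m
    by (induction m) (simp_all add: w_def w1_def w2_def pair_r_def)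
  have p: "(w1 ^^ ?p) A = A" unfolding w1_def by (rule P.rotation_period) (use k A in auto)
  have q: "(w2 ^^ ?q) B = B" unfolding w2_def by (rule Q.rotation_period) (use k B in auto)
  have "conn pair_r K z (w z)" for z
    unfolding w_def by (rule conn_step[OF conn_step[OF conn_refl k(2)] k(3)])
  then have "conn pair_r K (A, B) ((w ^^ e) (A, B))" by (rule conn_funpow)
  moreover obtain m where "e = ?p * m" using e(1) by (auto simp: cong_0_iff)
  then have "(w1 ^^ e) A = A" using funpow_period[OF p] by simp
  moreover have "(w2 ^^ e) B = w2 B" using funpow_cong[OF q e(2)] .
  ultimately show ?thesis unfolding w by (simp add: w2_def)
qed

text \<open>Rotations with consecutive indices telescope to the two steps \<open>c\<close> and
  \<open>d\<close>, as in \<open>act_tau\<close>; all colours passed lie in \<open>K\<close> because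
  it is an interval.\<close>

lemma two_steps_second:
  assumes K: "K = {i<..<j}" "j < n" and A: "A \<in> F1" and B: "B \<in> F2" and cd: "c \<in> K" "d \<in> K"
  shows "conn pair_r K (A, B) (A, r2 d (r2 c B))"
proof -
  have Kn: "K \<subseteq> {..<n}" using K by auto
  have up: "conn pair_r K (A, B) (A, r2 d (r2 c B))" if "c \<in> K" "d \<in> K" "c \<le> d" "B \<in> F2" for c d B
    using that(3,2)
  proof (induction rule: dec_induct)
    case base
    then show ?case using Q.r_invol[of c B] that Kn conn_refl[of pair_r K] by auto
  next
    case (step d)
    have d: "d \<in> K" "d < n" using step that(1) K by auto
    have c: "c < n" using that Kn by auto
    let ?B = "r2 d (r2 c B)"
    have rc: "r2 c B \<in> F2" using Q.r_closed c that by simp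
    then have B': "?B \<in> F2" using Q.r_closed d by simp
    have "conn pair_r K (A, B) (A, ?B)" using step d by simp
    \<comment> \<open>Both \<open>d\<close> and \<open>Suc d\<close> lie strictly between
      \<open>i\<close> and \<open>j\<close>, so \<open>Suc d\<close> is at least 2 and at most
      \<open>n - 2\<close>, where the orders are coprime.\<close>
    moreover have "conn pair_r K (A, ?B) (A, r2 (Suc d) (r2 (Suc d - 1) ?B))"
      by (rule rotate_second) (use step(4) d that(1) K A B' in auto)
    moreover have "r2 (Suc d - 1) ?B = r2 c B" using Q.r_invol[OF d(2) rc] by simp
    ultimately show ?case using conn_trans[of pair_r K "(A, ?B)"] by simp
  qed
  show ?thesis
  proof (cases "c \<le> d")
    case True
    then show ?thesis using up cd B by simp
  next
    case False
    have cn: "c < n" "d < n" using cd Kn by auto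
    let ?B = "r2 d (r2 c B)"
    have F: "r2 c B \<in> F2" "?B \<in> F2" using Q.r_closed cn B by auto
    \<comment> \<open>For \<open>d < c\<close> the path is built from its end and then
      reversed.\<close>
    have "conn pair_r K (A, ?B) (A, r2 c (r2 d ?B))" using up[of d c ?B] False cd F by simp
    moreover have "r2 c (r2 d ?B) = B" using Q.r_invol F cn B by simp
    ultimately have "conn pair_r K (A, ?B) (A, B)" by simp
    then show ?thesis by (rule prod.conn_sym[OF _ Kn]) (use A F in simp)
  qed
qed

lemma move_second:
  assumes K: "K = {i<..<j}" "j < n" and A: "A \<in> F1" and B: "B \<in> F2"
    and BB': "conn r2 K B B'" and par: "even2 B' = even2 B"
  shows "conn pair_r K (A, B) (A, B')"
proof -
  have Kn: "K \<subseteq> {..<n}" using K by auto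
  \<comment> \<open>At an odd stage parity forbids a path that fixes \<open>A\<close>; the invariant
    promises one after any further step in \<open>K\<close>.\<close>
  have "even2 B' = even2 B \<and> conn pair_r K (A, B) (A, B') \<or>
      even2 B' \<noteq> even2 B \<and> (\<forall>d\<in>K. conn pair_r K (A, B) (A, r2 d B'))"
    using BB'
  proof (induction rule: conn.induct)
    case conn_refl
    then show ?case using conn.conn_refl[of pair_r K "(A, B)"] by simp
  next
    case (conn_step B' c)
    have B': "B' \<in> F2" using Q.conn_closed[OF conn_step(1) Kn B] .
    have c: "c \<in> K" "c < n" using conn_step(2) Kn by auto
    have "conn pair_r K (A, B) (A, r2 d (r2 c B'))" if "conn pair_r K (A, B) (A, B')" "d \<in> K" for d
      by (rule conn_trans[OF two_steps_second[OF K A B' c(1) that(2)] that(1)])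
    then show ?case using conn_step.IH c Q.even_flag_r[OF c(2) B'] by auto
  qed
  then show ?thesis using par by simp
qed

text \<open>The path of the first component is lifted to pairs at the cost of a wrong second
  component \<open>B''\<close>, which is then corrected with the first one held fixed.\<close>

lemma mix_path_intersection:
  assumes ij: "i < j" "j < n" and z: "z \<in> F1 \<times> F2"
    and zw: "conn pair_r {i<..<n} z w" "conn pair_r {..<j} z w"
  shows "conn pair_r {i<..<j} z w"
proof -
  let ?K = "{i<..<j}"
  have K: "?K \<subseteq> {..<n}" using ij by auto
  obtain A B where AB: "z = (A, B)" "A \<in> F1" "B \<in> F2" using z by auto
  obtain A' B' where w: "w = (A', B')" by (cases w)
  have A': "conn r1 ?K A A'"
    using P.path_intersection[OF ij AB(2)] conn_fst zw AB(1) w by fastforce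
  have B': "conn r2 ?K B B'"
    using Q.path_intersection[OF ij AB(3)] conn_snd zw AB(1) w by fastforce
  obtain B'' where B'': "conn pair_r ?K z (A', B'')" using conn_lift[OF A', of B] AB by blast
  have F: "A' \<in> F1" "B'' \<in> F2" using prod.conn_closed[OF B'' K z] by auto
  have "conn r2 ?K B B''" using conn_snd[OF B''] AB by simp
  then have "conn r2 ?K B'' B" using Q.conn_sym K AB by blast
  then have B''B': "conn r2 ?K B'' B'" by (rule conn_trans[OF B'])
  have jn: "{..<j} \<subseteq> {..<n}" using ij by auto
  \<comment> \<open>Both parities are tied to the change of parity from \<open>A\<close> to
    \<open>A'\<close>, so the correction from \<open>B''\<close> to \<open>B'\<close> is
    even.\<close>
  have "even2 B' = even2 B''"
    using parity_conn[OF zw(2) jn z] parity_conn[OF B'' K z] w AB by auto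
  then have "conn pair_r ?K (A', B'') (A', B')"
    using move_second[OF refl ij(2) F B''B'] by simp
  then show ?thesis unfolding w using B'' by (rule conn_trans)
qed

section \<open>The group acting on pairs of flags\<close>

lemma pair_act_conn:
  assumes "conn pair_r I z w" "I \<subseteq> {..<n}" "z \<in> F1 \<times> F2" "g \<in> carrier G1 \<times> carrier G2"
  shows "conn pair_r I (pair_act g z) (pair_act g w)"
  using assms(1)
proof (induction rule: conn.induct)
  case conn_refl
  show ?case by (rule conn.conn_refl)
next
  case (conn_step w c)
  have "w \<in> F1 \<times> F2" using prod.conn_closed[OF conn_step(1)] assms by simp
  moreover have "c < n" using conn_step(2) assms by auto
  ultimately have "pair_act g (pair_r c w) = pair_r c (pair_act g w)"
    using P.act_r Q.act_r assms(4) by (auto simp: pair_act_def pair_r_def)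
  then show ?case using conn.conn_step[OF conn_step.IH conn_step(2)] by simp
qed

lemma pair_flags_subset: "pair_flags \<subseteq> F1 \<times> F2"
  using prod.conn_closed[of "{..<n}" "(x1, x2)"] P.x0 Q.x0 by (auto simp: pair_flags_def)

lemma pair_flags_conn: "z \<in> pair_flags \<Longrightarrow> w \<in> pair_flags \<Longrightarrow> conn pair_r {..<n} z w"
proof -
  assume zw: "z \<in> pair_flags" "w \<in> pair_flags"
  then have "conn pair_r {..<n} z (x1, x2)"
    using prod.conn_sym[of "{..<n}" "(x1, x2)" z] P.x0 Q.x0 by (simp add: pair_flags_def)
  then show ?thesis using conn_trans[of pair_r "{..<n}" "(x1, x2)" w z] zw by (simp add: pair_flags_def)
qed

lemma pair_r_pair_flags: "z \<in> pair_flags \<Longrightarrow> c < n \<Longrightarrow> pair_r c z \<in> pair_flags"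
  unfolding pair_flags_def mem_Collect_eq by (rule conn_step[of pair_r]) auto

lemma group_prod: "group (G1 \<times>\<times> G2)"
  by (rule DirProd_group[OF P.is_group Q.is_group])

lemma pair_gen_closed: "pair_gen ` {1..n - 1} \<subseteq> carrier (G1 \<times>\<times> G2)"
  using P.s_closed Q.s_closed P.two_le by (auto simp: pair_gen_def)

lemma pair_group_subgroup: "subgroup (carrier pair_group) (G1 \<times>\<times> G2)"
  using group.generate_is_subgroup[OF group_prod pair_gen_closed] by (simp add: pair_group_def)

lemma pair_group_closed: "g \<in> carrier pair_group \<Longrightarrow> g \<in> carrier G1 \<times> carrier G2"
  using subgroup.mem_carrier[OF pair_group_subgroup] by simp

lemma pair_group_x0:
  assumes "g \<in> carrier pair_group"
  shows "pair_act g (x1, x2) \<in> pair_flags"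
proof -
  let ?D = "G1 \<times>\<times> G2" and ?x = "(x1, x2)"
  interpret D: group ?D by (rule group_prod)
  have x: "?x \<in> F1 \<times> F2" using P.x0 Q.x0 by simp
  have gen: "pair_gen i \<in> carrier ?D \<and> conn pair_r {..<n} ?x (pair_act (pair_gen i) ?x)" if i: "i \<in> {1..n - 1}" for i
  proof -
    have "pair_act (pair_gen i) ?x = pair_r i (pair_r (i - 1) ?x)"
      using P.act_s[of i] Q.act_s[of i] i by (auto simp: pair_act_def pair_gen_def pair_r_def)
    moreover have "conn pair_r {..<n} ?x (pair_r i (pair_r (i - 1) ?x))"
      by (rule conn_step[OF conn_step[OF conn_refl]]) (use i in auto)
    ultimately show ?thesis using pair_gen_closed i by auto
  qed
  have mult: "pair_act (g \<otimes>\<^bsub>?D\<^esub> h) z = pair_act g (pair_act h z)"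
    if "g \<in> carrier ?D" "h \<in> carrier ?D" "z \<in> F1 \<times> F2" for g h z
    using that P.act_mult Q.act_mult by (auto simp: pair_act_def)
  have pair_act_one: "pair_act \<one>\<^bsub>?D\<^esub> z = z" if "z \<in> F1 \<times> F2" for z
    using that P.act_one Q.act_one by (auto simp: pair_act_def)
  have "g \<in> generate ?D (pair_gen ` {1..n - 1})" using assms by (simp add: pair_group_def)
  then have "g \<in> carrier ?D \<and> conn pair_r {..<n} ?x (pair_act g ?x)"
  proof (induction rule: generate.induct)
    case one
    then show ?case unfolding pair_act_one[OF x] using conn_refl[of pair_r "{..<n}" ?x] by simp
  next
    case (incl h)
    then show ?case using gen by blast
  next
    case (inv h)
    then have h: "h \<in> carrier ?D" "conn pair_r {..<n} ?x (pair_act h ?x)" using gen by blast+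
    have ih: "inv\<^bsub>?D\<^esub> h \<in> carrier ?D" by (rule D.inv_closed[OF h(1)])
    then have ix: "pair_act (inv\<^bsub>?D\<^esub> h) ?x \<in> F1 \<times> F2"
      using P.act_closed Q.act_closed P.x0 Q.x0 by (auto simp: pair_act_def)
    have "conn pair_r {..<n} (pair_act (inv\<^bsub>?D\<^esub> h) ?x) (pair_act (inv\<^bsub>?D\<^esub> h) (pair_act h ?x))"
      using pair_act_conn[OF h(2) subset_refl x, of "inv\<^bsub>?D\<^esub> h"] ih by simp
    also have "pair_act (inv\<^bsub>?D\<^esub> h) (pair_act h ?x) = ?x"
      using mult[OF ih h(1) x] pair_act_one[OF x] D.l_inv[OF h(1)] by simp
    finally show ?case using prod.conn_sym[OF _ subset_refl ix] ih by blast
  next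
    case (eng g h)
    then have "conn pair_r {..<n} (pair_act g ?x) (pair_act g (pair_act h ?x))"
      using pair_act_conn[OF _ subset_refl x, of "pair_act h ?x" g] by simp
    moreover have "g \<otimes>\<^bsub>?D\<^esub> h \<in> carrier ?D" using eng D.m_closed by blast
    ultimately show ?case
      using eng mult[of g h, OF _ _ x] conn_trans[of pair_r "{..<n}" "pair_act g ?x" "pair_act g (pair_act h ?x)" ?x]
      by simp
  qed
  then show ?thesis by (simp add: pair_flags_def)
qed

lemma pair_group_act_closed:
  assumes "g \<in> carrier pair_group" "z \<in> pair_flags"
  shows "pair_act g z \<in> pair_flags"
proof -
  have "conn pair_r {..<n} (x1, x2) z" using assms by (simp add: pair_flags_def)
  then have "conn pair_r {..<n} (pair_act g (x1, x2)) (pair_act g z)"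
    using pair_act_conn[of "{..<n}" "(x1, x2)" z g] pair_group_closed[OF assms(1)] P.x0 Q.x0 by simp
  moreover have "conn pair_r {..<n} (x1, x2) (pair_act g (x1, x2))"
    using pair_group_x0[OF assms(1)] by (simp add: pair_flags_def)
  ultimately show ?thesis unfolding pair_flags_def mem_Collect_eq by (rule conn_trans)
qed

text \<open>Most properties are inherited from the components, and connectivity holds by the choice
  of \<open>pair_flags\<close>. Coprimality enters through \<open>mix_path_intersection\<close>
  alone.\<close>

lemma rotary_polytope_mix:
  "rotary_polytope n pair_flags pair_r pair_group pair_act pair_gen (x1, x2) (\<lambda>z. even1 (fst z))"
proof -
  interpret D: group "G1 \<times>\<times> G2" by (rule group_prod)
  interpret M: group pair_group
    using subgroup.subgroup_is_group[OF pair_group_subgroup group_prod] by (simp add: pair_group_def)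
  have F: "fst z \<in> F1" "snd z \<in> F2" if "z \<in> pair_flags" for z
    using pair_flags_subset that by auto
  have G: "fst g \<in> carrier G1" "snd g \<in> carrier G2" if "g \<in> carrier pair_group" for g
    using pair_group_closed[OF that] by auto
  have pair_gen_in: "pair_gen i \<in> carrier pair_group" if "1 \<le> i" "i < n" for i
    unfolding pair_group_def by simp (rule generate.incl, use that in auto)
  have mult: "g \<otimes>\<^bsub>pair_group\<^esub> h = (fst g \<otimes>\<^bsub>G1\<^esub> fst h, snd g \<otimes>\<^bsub>G2\<^esub> snd h)" for g h
    by (simp add: pair_group_def mult_DirProd')
  have one: "\<one>\<^bsub>pair_group\<^esub> = (\<one>\<^bsub>G1\<^esub>, \<one>\<^bsub>G2\<^esub>)"
    by (simp add: pair_group_def)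
  show ?thesis
  proof unfold_locales
    fix c z assume c: "c < n" and z: "z \<in> pair_flags"
    show "pair_r c z \<in> pair_flags" using pair_r_pair_flags c z by simp
    show "pair_r c (pair_r c z) = z" using P.r_invol Q.r_invol F[OF z] c by (simp add: pair_r_def)
    show "pair_r c z \<noteq> z" using P.r_no_fixpoint[OF c F(1)[OF z]] by (auto simp: pair_r_def prod_eq_iff)
    show "even1 (fst (pair_r c z)) = (\<not> even1 (fst z))"
      using P.even_flag_r[OF c F(1)[OF z]] by (simp add: pair_r_def)
  next
    fix c d z assume "c + 1 < d" "d < n" "z \<in> pair_flags"
    then show "pair_r c (pair_r d z) = pair_r d (pair_r c z)"
      using P.r_comm[of c d "fst z"] Q.r_comm[of c d "snd z"] F by (simp add: pair_r_def)
  next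
    fix z w assume "z \<in> pair_flags" "w \<in> pair_flags"
    then show "conn pair_r {..<n} z w" by (rule pair_flags_conn)
  next
    fix i j z w assume "i < j" "j < n" "z \<in> pair_flags" "conn pair_r {i<..<n} z w" "conn pair_r {..<j} z w"
    then show "conn pair_r {i<..<j} z w" using mix_path_intersection pair_flags_subset by blast
  next
    show "2 \<le> n" by (rule P.two_le)
    show x0: "(x1, x2) \<in> pair_flags" by (simp add: pair_flags_def conn_refl)
    fix z assume "z \<in> pair_flags"
    then show "conn pair_r {..<n} (x1, x2) z" by (simp add: pair_flags_def)
    show "pair_act \<one>\<^bsub>pair_group\<^esub> z = z" using P.act_one Q.act_one F[OF \<open>z \<in> pair_flags\<close>] by (simp add: pair_act_def one)
  next
    fix g z assume "g \<in> carrier pair_group" "z \<in> pair_flags"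
    then show "pair_act g z \<in> pair_flags" by (rule pair_group_act_closed)
    fix c assume "c < n"
    then show "pair_act g (pair_r c z) = pair_r c (pair_act g z)"
      using P.act_r Q.act_r F[OF \<open>z \<in> pair_flags\<close>] G[OF \<open>g \<in> _\<close>] by (simp add: pair_act_def pair_r_def)
  next
    fix g h z assume "g \<in> carrier pair_group" "h \<in> carrier pair_group" "z \<in> pair_flags"
    then show "pair_act (g \<otimes>\<^bsub>pair_group\<^esub> h) z = pair_act g (pair_act h z)"
      using P.act_mult Q.act_mult F G by (simp add: pair_act_def mult)
  next
    fix i assume i: "1 \<le> i" "i < n"
    then show "pair_gen i \<in> carrier pair_group" by (rule pair_gen_in)
    show "pair_act (pair_gen i) (x1, x2) = pair_r i (pair_r (i - 1) (x1, x2))"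
      using P.act_s[OF i] Q.act_s[OF i] by (simp add: pair_act_def pair_gen_def pair_r_def)
  next
    have "pair_gen ` {1..n - 1} \<subseteq> carrier pair_group" using pair_gen_in P.two_le by auto
    then have "generate pair_group (pair_gen ` {1..n - 1}) = generate (G1 \<times>\<times> G2) (pair_gen ` {1..n - 1})"
      using D.generate_consistent[OF _ pair_group_subgroup] by (simp add: pair_group_def)
    then show "carrier pair_group = generate pair_group (pair_gen ` {1..n - 1})" by (simp add: pair_group_def)
  next
    fix g assume g: "g \<in> carrier pair_group" "pair_act g (x1, x2) = (x1, x2)"
    then have "fst g = \<one>\<^bsub>G1\<^esub>" "snd g = \<one>\<^bsub>G2\<^esub>"
      using P.act_free[of "fst g"] Q.act_free[of "snd g"] G by (auto simp: pair_act_def)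
    then show "g = \<one>\<^bsub>pair_group\<^esub>" by (simp add: one prod_eq_iff)
  qed
qed

end

lemma rotary_polytope_flags:
  assumes "2 \<le> n" "chiral_polytope n R \<or> directly_regular_polytope n R" "A \<in> flags R"
  shows "\<exists>e. rotary_polytope n (flags R) (\<lambda>c. adj_flag R (int c)) (rotation_group n R A) image (\<sigma> n R A) A e"
proof -
  interpret polytope n R
    using assms(2) by unfold_locales
      (auto simp: chiral_polytope_def directly_regular_polytope_def regular_polytope_def)
  obtain e where "oriented_rotary n (flags R) adj (rotation_group n R A) image (\<sigma> n R A) A e"
    using oriented_rotary_flags assms by blast
  then have "rotary_polytope n (flags R) adj (rotation_group n R A) image (\<sigma> n R A) A e"
    using polytopal_maniplex_flags by (simp add: rotary_polytope_def)
  then show ?thesis by blast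
qed

theorem theorem3p7:
  fixes n :: nat and P :: "'a rel" and Q :: "'b rel" and p q :: "nat \<Rightarrow> nat"
    and \<Phi> :: "'a set" and \<Psi> :: "'b set"
  assumes "n \<ge> 2"
    and "chiral_polytope n P \<or> directly_regular_polytope n P"
    and "chiral_polytope n Q \<or> directly_regular_polytope n Q"
    and "\<Phi> \<in> flags P" and "\<Psi> \<in> flags Q"
    and "has_type n P \<Phi> p" and "has_type n Q \<Psi> q"
    and "\<And>i. i \<in> {2..n - 2} \<Longrightarrow> coprime (p i) (q i)"
  shows "chiral_polytope n (mix n P \<Phi> Q \<Psi>) \<or> directly_regular_polytope n (mix n P \<Phi> Q \<Psi>)"
proof -
  obtain e1 where P: "rotary_polytope n (flags P) (\<lambda>c. adj_flag P (int c))
      (rotation_group n P \<Phi>) image (\<sigma> n P \<Phi>) \<Phi> e1"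
    using rotary_polytope_flags assms by blast
  obtain e2 where Q: "rotary_polytope n (flags Q) (\<lambda>c. adj_flag Q (int c))
      (rotation_group n Q \<Psi>) image (\<sigma> n Q \<Psi>) \<Psi> e2"
    using rotary_polytope_flags assms by blast
  have "coprime (group.ord (rotation_group n P \<Phi>) (\<sigma> n P \<Phi> i)) (group.ord (rotation_group n Q \<Psi>) (\<sigma> n Q \<Psi> i))"
    if "i \<in> {2..n - 2}" for i
  proof -
    have "i \<in> {1..n - 1}" using that by auto
    then show ?thesis using assms(6,7) assms(8)[OF that] by (simp add: has_type_def)
  qed
  with P Q interpret rotary_pair n "flags P" "\<lambda>c. adj_flag P (int c)" "rotation_group n P \<Phi>" image "\<sigma> n P \<Phi>" \<Phi> e1
    "flags Q" "\<lambda>c. adj_flag Q (int c)" "rotation_group n Q \<Psi>" image "\<sigma> n Q \<Psi>" \<Psi> e2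
    by (simp add: rotary_pair_def rotary_pair_axioms_def)
  have pair_gen: "pair_gen = mix_generator n P \<Phi> Q \<Psi>" by (rule ext) (simp add: pair_gen_def mix_generator_def)
  \<comment> \<open>\<open>pair_group\<close> is built so that it unfolds literally to the group of
    the mix.\<close>
  have "mix n P \<Phi> Q \<Psi> = coset_poset pair_group n pair_gen"
    unfolding mix_def mix_group_def pair_group_def pair_gen ..
  then show ?thesis using rotary_polytope.coset_poset_polytope[OF rotary_polytope_mix] by simp
qed

end
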